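(* Let $A$ be a unital associative algebra over a field $\mathbb{K}$, and let $\varphi,\psi\colon A\to\mathbb{K}$ be two unital linear maps (states). Let $\Phi,\Psi\in G$ be the characters on $H=T(T_+(A))$ extending $\varphi$ and $\psi$, i.e. $\Phi(a_1\cdots a_n)=\varphi(a_1\cdot_A\cdots\cdot_A a_n)$ and $\Psi(a_1\cdots a_n)=\psi(a_1\cdot_A\cdots\cdot_A a_n)$ on words. Let $\beta\in g$ be the boolean infinitesimal cumulant character of $\Phi$, i.e. $\Phi=\mathcal{E}_\succ(\beta)$, and let $R\in g$ be the infinitesimal character determined by $$\beta=\Psi^{*-1}\succ R\prec\Psi\qquad(\text{equivalently } R=\Psi\succ\beta\prec\Psi^{*-1}).$$ Then $R$ computes the multivariate conditionally free cumulants of the pair $(\varphi,\psi)$: for all $n\ge1$ and $a_1,\dots,a_n\in A$, $$R(a_1\cdots a_n)=R_n^{(\varphi,\psi)}(a_1,\dots,a_n).$$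
   Context: Conditionally free cumulants. $NC_n$ is the set of non-crossing partitions of $[n]=\{1,\dots,n\}$. A block $\pi_i$ of $\pi\in NC_n$ is inner if there are a block $\pi_j$ of $\pi$ and $a,b\in\pi_j$ with $a<c<b$ for all $c\in\pi_i$; otherwise it is outer. For a family of multilinear maps $f_k\colon A^k\to\mathbb{K}$ and a block $B=\{j_1<\dots<j_k\}$ write $f_{|B|}(a_B):=f_k(a_{j_1},\dots,a_{j_k})$. The free cumulants $k_n^\psi\colon A^n\to\mathbb{K}$ of $\psi$ are the multilinear maps determined recursively by $\psi(a_1\cdot_A\cdots\cdot_A a_n)=\sum_{\pi\in NC_n}\prod_{\pi_l\in\pi}k^\psi_{|\pi_l|}(a_{\pi_l})$ for all $n\geq 1$. The c-free cumulants $R_n^{(\varphi,\psi)}\colon A^n\to\mathbb{K}$ are the multilinear maps determined recursively by $$\varphi(a_1\cdot_A\cdots\cdot_A a_n)=\sum_{\pi\in NC_n}\ \prod_{\pi_l\in\pi\ \mathrm{inner}}k^\psi_{|\pi_l|}(a_{\pi_l})\prod_{\pi_l\in\pi\ \mathrm{outer}}R^{(\varphi,\psi)}_{|\pi_l|}(a_{\pi_l})\qquad(n\ge1).$$ The Hopf algebra $H$. $T_+(A)=\bigoplus_{n>0}A^{\otimes n}$ is the space of non-empty words $a_1\cdots a_n$ (tensors, not products in $A$). $H:=T(T_+(A))=\bigoplus_{n\ge0}T_+(A)^{\otimes n}$, with elements written $w_1|\cdots|w_m$, product given by concatenation with bars, and unit $\mathbf 1$ (the empty word; bars around empty words are dropped).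 $H_+:=\bigoplus_{n>0}T_+(A)^{\otimes n}$. For $S=\{s_1<\dots<s_p\}\subseteq[n]$, $a_S:=a_{s_1}\cdots a_{s_p}$, $a_\emptyset:=\mathbf 1$. For $S\subseteq[n]$, let $J_1,\dots,J_k$ (in increasing order) be the connected components of $[n]\setminus S$, i.e. its maximal subsets of consecutive integers, and $a_{J^S_{[n]}}:=a_{J_1}|\cdots|a_{J_k}$ ($=\mathbf 1$ if $S=[n]$). The coproduct is $\Delta(a_1\cdots a_n)=\sum_{S\subseteq[n]}a_S\otimes a_{J^S_{[n]}}$, $\Delta(\mathbf 1)=\mathbf 1\otimes\mathbf 1$, extended multiplicatively by $\Delta(w_1|\cdots|w_m)=\Delta(w_1)\cdots\Delta(w_m)$. It splits as $\Delta=\Delta_\prec+\Delta_\succ$ on $H_+$, where $\Delta_\prec(a_1\cdots a_n)=\sum_{1\in S\subseteq[n]}a_S\otimes a_{J^S_{[n]}}$, $\Delta_\succ(a_1\cdots a_n)=\sum_{1\notin S\subseteq[n]}a_S\otimes a_{J^S_{[n]}}$, and $\Delta_{\prec}(w_1|\cdots|w_m)=\Delta_\prec(w_1)\Delta(w_2)\cdots\Delta(w_m)$, $\Delta_{\succ}(w_1|\cdots|w_m)=\Delta_\succ(w_1)\Delta(w_2)\cdots\Delta(w_m)$. Put $\Delta_\prec^+(w)=\Delta_\prec(w)-w\otimes\mathbf 1$, $\Delta^+_\succ(w)=\Delta_\succ(w)-\mathbf 1\otimes w$ for $w\in H_+$. Products on the dual. On $\mathrm{Lin}(H,\mathbb{K})$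 the convolution product is $\Gamma*\Lambda=m_{\mathbb K}(\Gamma\otimes\Lambda)\Delta$ with unit $e$ ($e(\mathbf 1)=1$, $e|_{H_+}=0$). For $\Gamma,\Lambda\in\mathrm{Lin}(H_+,\mathbb{K})$ (maps vanishing on $\mathbf 1$): $\Gamma\prec\Lambda=m_{\mathbb K}(\Gamma\otimes\Lambda)\Delta^+_\prec$ and $\Gamma\succ\Lambda=m_{\mathbb K}(\Gamma\otimes\Lambda)\Delta^+_\succ$; bilinearly extended by $e\prec\Lambda=0$, $e\succ\Lambda=\Lambda$, $\Lambda\prec e=\Lambda$, $\Lambda\succ e=0$ ($e\prec e$, $e\succ e$ are not defined). One has $(\Gamma\succ\Lambda)\prec\Theta=\Gamma\succ(\Lambda\prec\Theta)$, so $\Gamma\succ\Lambda\prec\Theta$ is unambiguous. Characters. $G\subset\mathrm{Lin}(H,\mathbb{K})$ is the group (under $*$) of characters: $\Phi(\mathbf 1)=1$, $\Phi(w|w')=\Phi(w)\Phi(w')$; $\Phi^{*-1}$ denotes the inverse. $g$ is the space of infinitesimal characters: $\kappa(\mathbf 1)=0$ and $\kappa(w|w')=0$ for $w,w'\in H_+$. For $\alpha\in g$: $\mathcal{E}_\succ(\alpha)=e+\sum_{n>0}\alpha^{\succ n}$ with $\alpha^{\succ 0}=e$, $\alpha^{\succ n}=\alpha^{\succ n-1}\succ\alpha$ (a finite sum on each element of $H$); equivalently it solves $Y=e+Y\succ\alpha$. The map $\mathcal{E}_\succ$ is a bijection $g\to G$. *)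

theory Defs
  imports
    Complex_Main
    "HOL-Algebra.Group"
    "HOL-Library.Disjoint_Sets"
    "HOL-Library.Multiset"
begin

section \<open>Unital algebras and unital linear functionals\<close>

text \<open>No commutativity is assumed. The class \<open>ring_1\<close> contains \<open>0 \<noteq> 1\<close>; this excludes only the
  zero algebra, which has no unital linear functional.\<close>

locale unital_algebra = vector_space scale
  for scale :: "'k::field \<Rightarrow> 'a::ring_1 \<Rightarrow> 'a" +
  assumes scale_mult_left: "scale c x * y = scale c (x * y)"
    and scale_mult_right: "x * scale c y = scale c (x * y)"

definition unital_linear :: "('k::field \<Rightarrow> 'a::ring_1 \<Rightarrow> 'a) \<Rightarrow> ('a \<Rightarrow> 'k) \<Rightarrow> bool" where
  "unital_linear scale f \<longleftrightarrow> Vector_Spaces.linear scale (*) f \<and> f 1 = 1"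


section \<open>Non-crossing partitions and cumulants\<close>

text \<open>Positions in a sequence are counted from \<open>0\<close>, so the set \<open>{1,\<dots>,n}\<close> is rendered as \<open>{..<n}\<close>.
  A tuple \<open>(a\<^sub>1,\<dots>,a\<^sub>n)\<close> is a list \<open>as\<close> of length \<open>n\<close>; then \<open>nths as B\<close> is the sub-tuple \<open>a\<^sub>B\<close>, and
  \<open>prod_list as\<close> is the product in \<open>A\<close>.\<close>

definition noncrossing :: "nat set set \<Rightarrow> bool" where
  "noncrossing \<pi> \<longleftrightarrow>
     (\<forall>V\<in>\<pi>. \<forall>W\<in>\<pi>. \<forall>a b c d. a < b \<and> b < c \<and> c < d \<and> a \<in> V \<and> c \<in> V \<and> b \<in> W \<and> d \<in> W \<longrightarrow> V = W)"

definition NC :: "nat \<Rightarrow> nat set set set" where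
  "NC n = {\<pi>. partition_on {..<n} \<pi> \<and> noncrossing \<pi>}"

definition inner_block :: "nat set set \<Rightarrow> nat set \<Rightarrow> bool" where
  "inner_block \<pi> V \<longleftrightarrow> (\<exists>W\<in>\<pi>. \<exists>a\<in>W. \<exists>b\<in>W. \<forall>c\<in>V. a < c \<and> c < b)"

lemma finite_NC: "finite (NC n)"
proof (rule finite_subset)
  show "NC n \<subseteq> Pow (Pow {..<n})"
    by (auto simp: NC_def partition_on_def)
qed simp

lemma one_block_NC: "0 < n \<Longrightarrow> {{..<n}} \<in> NC n"
  by (auto simp: NC_def partition_on_def noncrossing_def)

lemma length_nths_block:
  assumes "\<pi> \<in> NC (length as) - {{{..<length as}}}" and "V \<in> \<pi>"
  shows "length (nths as V) < length as"
proof -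
  have p: "partition_on {..<length as} \<pi>" and ne: "\<pi> \<noteq> {{..<length as}}"
    using assms by (auto simp: NC_def)
  have sub: "V \<subseteq> {..<length as}"
    using p assms(2) by (auto simp: partition_on_def)
  have "V \<noteq> {..<length as}"
  proof
    assume V: "V = {..<length as}"
    have "W = V" if W: "W \<in> \<pi>" for W
    proof (rule ccontr)
      assume "W \<noteq> V"
      then have "W \<inter> V = {}"
        using p W assms(2) by (auto simp: partition_on_def disjoint_def)
      moreover have "W \<subseteq> V" "W \<noteq> {}"
        using p W V by (auto simp: partition_on_def)
      ultimately show False by blast
    qed
    with assms(2) V ne show False by blast
  qed
  with sub have "V \<subset> {..<length as}" by blast
  moreover have "length (nths as V) = card V"
  proof -
    have "{i. i < length as \<and> i \<in> V} = V" using sub by auto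
    then show ?thesis by (simp add: length_nths)
  qed
  ultimately show ?thesis
    using psubset_card_mono[of "{..<length as}" V] by simp
qed

text \<open>The defining moment-cumulant relations are solved for the term of the one-block partition;
  the relations themselves are derived below. The value at the empty list is irrelevant.\<close>

function free_cumulant :: "('a::monoid_mult \<Rightarrow> 'k::field) \<Rightarrow> 'a list \<Rightarrow> 'k" where
  "free_cumulant \<psi> as = \<psi> (prod_list as) -
     (\<Sum>\<pi> \<in> NC (length as) - {{{..<length as}}}. \<Prod>V\<in>\<pi>. free_cumulant \<psi> (nths as V))"
  by pat_completeness auto
termination
  by (relation "measure (\<lambda>(\<psi>, as). length as)") (auto intro: length_nths_block)

declare free_cumulant.simps [simp del]

function cfree_cumulant ::
    "('a::monoid_mult \<Rightarrow> 'k::field) \<Rightarrow> ('a \<Rightarrow> 'k) \<Rightarrow> 'a list \<Rightarrow> 'k" where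
  "cfree_cumulant \<phi> \<psi> as = \<phi> (prod_list as) -
     (\<Sum>\<pi> \<in> NC (length as) - {{{..<length as}}}.
        (\<Prod>V \<in> {V\<in>\<pi>. inner_block \<pi> V}. free_cumulant \<psi> (nths as V)) *
        (\<Prod>V \<in> {V\<in>\<pi>. \<not> inner_block \<pi> V}. cfree_cumulant \<phi> \<psi> (nths as V)))"
  by pat_completeness auto
termination
  by (relation "measure (\<lambda>(\<phi>, \<psi>, as). length as)") (auto intro: length_nths_block)

declare cfree_cumulant.simps [simp del]

lemma nths_lessThan_length: "nths as {..<length as} = as"
  by (simp add: nths_upt_eq_take flip: lessThan_atLeast0)

lemma free_moment_cumulant:
  assumes "as \<noteq> []"
  shows "\<psi> (prod_list as) = (\<Sum>\<pi> \<in> NC (length as). \<Prod>V\<in>\<pi>. free_cumulant \<psi> (nths as V))"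
proof -
  have one: "{{..<length as}} \<in> NC (length as)"
    using assms by (intro one_block_NC) simp
  show ?thesis
    by (subst sum.remove[OF finite_NC one])
      (simp add: nths_lessThan_length free_cumulant.simps[of \<psi> as])
qed

lemma cfree_moment_cumulant:
  assumes "as \<noteq> []"
  shows "\<phi> (prod_list as) =
    (\<Sum>\<pi> \<in> NC (length as).
       (\<Prod>V \<in> {V\<in>\<pi>. inner_block \<pi> V}. free_cumulant \<psi> (nths as V)) *
       (\<Prod>V \<in> {V\<in>\<pi>. \<not> inner_block \<pi> V}. cfree_cumulant \<phi> \<psi> (nths as V)))"
proof -
  let ?V = "{..<length as}"
  have one: "{?V} \<in> NC (length as)"
    using assms by (intro one_block_NC) simp
  have "\<not> inner_block {?V} ?V"
    by (auto simp: inner_block_def)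
  then have "{V\<in>{?V}. inner_block {?V} V} = {}" "{V\<in>{?V}. \<not> inner_block {?V} V} = {?V}"
    by auto
  then show ?thesis
    by (subst sum.remove[OF finite_NC one], simp only:)
      (simp add: nths_lessThan_length cfree_cumulant.simps[of \<phi> \<psi> as])
qed


section \<open>The Hopf algebra of words and its coproducts\<close>

text \<open>A non-empty word is given by its first letter and the list of the remaining ones, and
  \<open>w\<^sub>1|\<dots>|w\<^sub>m\<close> is the list \<open>[w\<^sub>1,\<dots>,w\<^sub>m]\<close>; these are the pure tensors that span \<open>H = T(T\<^sub>+(A))\<close>. The bar
  product is \<open>@\<close>, the unit is \<open>[]\<close>, and \<open>H\<^sub>+\<close> is spanned by the non-empty lists.\<close>

type_synonym 'a word = "'a \<times> 'a list"
type_synonym 'a barword = "'a word list"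

definition letters :: "'a word \<Rightarrow> 'a list" where
  "letters w = fst w # snd w"

fun bar :: "'a list \<Rightarrow> 'a barword" where
  "bar [] = []"
| "bar (a # as) = [(a, as)]"

definition conn_component :: "nat set \<Rightarrow> nat \<Rightarrow> nat set" where
  "conn_component X i = {j. {min i j..max i j} \<subseteq> X}"

definition components :: "nat set \<Rightarrow> nat set list" where
  "components X =
     map (conn_component X) (sorted_list_of_set ((\<lambda>i. Min (conn_component X i)) ` X))"

text \<open>\<open>split as S\<close> represents the tensor of \<open>a\<^sub>S\<close> with \<open>a\<^sub>J\<^sub>1|\<dots>|a\<^sub>J\<^sub>k\<close>.\<close>

definition split :: "'a list \<Rightarrow> nat set \<Rightarrow> 'a barword \<times> 'a barword" where
  "split as S =
     (bar (nths as S), concat (map (\<lambda>J. bar (nths as J)) (components ({..<length as} - S))))"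

text \<open>The multiset of pairs \<open>(u, v)\<close> represents the sum of the tensors of \<open>u\<close> with \<open>v\<close> in the tensor
  square of \<open>H\<close>; all coefficients occurring in the coproducts are natural numbers.\<close>

definition tensor_mult ::
    "('a barword \<times> 'a barword) multiset \<Rightarrow> ('a barword \<times> 'a barword) multiset
      \<Rightarrow> ('a barword \<times> 'a barword) multiset" where
  "tensor_mult M N = (\<Sum>(u, v)\<in>#M. image_mset (\<lambda>(u', v'). (u @ u', v @ v')) N)"

definition coprod_word :: "'a word \<Rightarrow> ('a barword \<times> 'a barword) multiset" where
  "coprod_word w = image_mset (split (letters w)) (mset_set {S. S \<subseteq> {..<length (letters w)}})"

definition coprod_left_word :: "'a word \<Rightarrow> ('a barword \<times> 'a barword) multiset" where
  "coprod_left_word w =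
     image_mset (split (letters w)) (mset_set {S. S \<subseteq> {..<length (letters w)} \<and> 0 \<in> S})"

definition coprod_right_word :: "'a word \<Rightarrow> ('a barword \<times> 'a barword) multiset" where
  "coprod_right_word w =
     image_mset (split (letters w)) (mset_set {S. S \<subseteq> {..<length (letters w)} \<and> 0 \<notin> S})"

fun coprod :: "'a barword \<Rightarrow> ('a barword \<times> 'a barword) multiset" where
  "coprod [] = {#([], [])#}"
| "coprod (w # ws) = tensor_mult (coprod_word w) (coprod ws)"

text \<open>The half coproducts live on \<open>H\<^sub>+\<close>; the value \<open>{#}\<close> at \<open>[]\<close> makes the products below vanish
  at the unit.\<close>

fun coprod_left :: "'a barword \<Rightarrow> ('a barword \<times> 'a barword) multiset" where
  "coprod_left [] = {#}"
| "coprod_left (w # ws) = tensor_mult (coprod_left_word w) (coprod ws)"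

fun coprod_right :: "'a barword \<Rightarrow> ('a barword \<times> 'a barword) multiset" where
  "coprod_right [] = {#}"
| "coprod_right (w # ws) = tensor_mult (coprod_right_word w) (coprod ws)"

text \<open>For \<open>ws \<noteq> []\<close> the subtracted pairs do occur (take every \<open>S\<close> full, resp. every \<open>S\<close> empty), so the
  multiset difference is the difference of the sums.\<close>

definition coprod_left_plus :: "'a barword \<Rightarrow> ('a barword \<times> 'a barword) multiset" where
  "coprod_left_plus ws = coprod_left ws - {#(ws, [])#}"

definition coprod_right_plus :: "'a barword \<Rightarrow> ('a barword \<times> 'a barword) multiset" where
  "coprod_right_plus ws = coprod_right ws - {#([], ws)#}"


section \<open>Linear functionals on the Hopf algebra\<close>

text \<open>By the universal property of the tensor product, a linear functional on \<open>H\<close> is a function on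
  bar words that is linear in each letter separately. A tensor written as a sum of pure tensors is
  paired with two functionals termwise.\<close>

definition Lin_H :: "('k::field \<Rightarrow> 'a::ring_1 \<Rightarrow> 'a) \<Rightarrow> ('a barword \<Rightarrow> 'k) set" where
  "Lin_H scale = {\<Gamma>. \<forall>us vs xs ys.
     Vector_Spaces.linear scale (*) (\<lambda>a. \<Gamma> (us @ bar (xs @ a # ys) @ vs))}"

definition conv :: "('a barword \<Rightarrow> 'k::field) \<Rightarrow> ('a barword \<Rightarrow> 'k) \<Rightarrow> 'a barword \<Rightarrow> 'k" where
  "conv \<Gamma> \<Lambda> ws = (\<Sum>(u, v)\<in>#coprod ws. \<Gamma> u * \<Lambda> v)"

definition counit :: "'a barword \<Rightarrow> 'k::field" where
  "counit ws = (if ws = [] then 1 else 0)"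

text \<open>Every functional is \<open>\<Gamma> = \<Gamma> [] e + \<Gamma>\<^sub>+\<close> with \<open>\<Gamma>\<^sub>+\<close> vanishing at the unit. The half products are
  the bilinear extensions by \<open>e \<prec> \<Lambda> = 0\<close>, \<open>\<Lambda> \<prec> e = \<Lambda>\<close>, \<open>e \<succ> \<Lambda> = \<Lambda>\<close>, \<open>\<Lambda> \<succ> e = 0\<close> for \<open>\<Lambda>\<close> vanishing at
  the unit. They are meaningful only if \<open>\<Gamma> [] = 0\<close> or \<open>\<Lambda> [] = 0\<close>.\<close>

definition plus_part :: "('a barword \<Rightarrow> 'k::field) \<Rightarrow> 'a barword \<Rightarrow> 'k" where
  "plus_part \<Gamma> ws = (if ws = [] then 0 else \<Gamma> ws)"

definition half_left ::
    "('a barword \<Rightarrow> 'k::field) \<Rightarrow> ('a barword \<Rightarrow> 'k) \<Rightarrow> 'a barword \<Rightarrow> 'k" (infixl "\<prec>" 70) where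
  "(\<Gamma> \<prec> \<Lambda>) ws =
     (\<Sum>(u, v)\<in>#coprod_left_plus ws. plus_part \<Gamma> u * plus_part \<Lambda> v) + plus_part \<Gamma> ws * \<Lambda> []"

definition half_right ::
    "('a barword \<Rightarrow> 'k::field) \<Rightarrow> ('a barword \<Rightarrow> 'k) \<Rightarrow> 'a barword \<Rightarrow> 'k" (infixl "\<succ>" 70) where
  "(\<Gamma> \<succ> \<Lambda>) ws =
     (\<Sum>(u, v)\<in>#coprod_right_plus ws. plus_part \<Gamma> u * plus_part \<Lambda> v) + \<Gamma> [] * plus_part \<Lambda> ws"

definition characters :: "('k::field \<Rightarrow> 'a::ring_1 \<Rightarrow> 'a) \<Rightarrow> ('a barword \<Rightarrow> 'k) set" where
  "characters scale = {\<Phi> \<in> Lin_H scale. \<Phi> [] = 1 \<and> (\<forall>w w'. \<Phi> (w @ w') = \<Phi> w * \<Phi> w')}"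

definition character_group :: "('k::field \<Rightarrow> 'a::ring_1 \<Rightarrow> 'a) \<Rightarrow> ('a barword \<Rightarrow> 'k) monoid" where
  "character_group scale = \<lparr>carrier = characters scale, monoid.mult = conv, one = counit\<rparr>"

definition inf_characters :: "('k::field \<Rightarrow> 'a::ring_1 \<Rightarrow> 'a) \<Rightarrow> ('a barword \<Rightarrow> 'k) set" where
  "inf_characters scale =
     {\<kappa> \<in> Lin_H scale. \<kappa> [] = 0 \<and> (\<forall>w w'. w \<noteq> [] \<and> w' \<noteq> [] \<longrightarrow> \<kappa> (w @ w') = 0)}"

fun right_power :: "('a barword \<Rightarrow> 'k::field) \<Rightarrow> nat \<Rightarrow> 'a barword \<Rightarrow> 'k" where
  "right_power \<alpha> 0 = counit"
| "right_power \<alpha> (Suc n) = right_power \<alpha> n \<succ> \<alpha>"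

text \<open>The sum runs over the finitely many \<open>n > 0\<close> with a non-zero term.\<close>

definition exp_right :: "('a barword \<Rightarrow> 'k::field) \<Rightarrow> 'a barword \<Rightarrow> 'k" where
  "exp_right \<alpha> ws =
     counit ws + (\<Sum>n \<in> {n. 0 < n \<and> right_power \<alpha> n ws \<noteq> 0}. right_power \<alpha> n ws)"

end

theory Submission
  imports Defs
begin

text \<open>Coassociativity of the unshuffle coproduct turns \<open>\<beta> = \<Psi>\<^sup>-\<^sup>1 \<succ> R \<prec> \<Psi>\<close> into \<open>\<Psi> \<succ> \<beta> = R \<prec> \<Psi>\<close>, which no longer
  involves the inverse. On a word the left-hand side is the sum over all prefixes of \<open>\<beta>(prefix) \<Psi>(rest)\<close>;
  sorting the right-hand side by the last letter selected in \<open>R\<close> gives a sum of the same shape, so that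
  \<open>\<beta>(a\<^sub>1\<dots>a\<^sub>n)\<close> is the sum of \<open>R(a\<^sub>S) \<Psi>(gaps)\<close> over all \<open>S\<close> containing both \<open>1\<close> and \<open>n\<close>. Substituting this into
  \<open>\<Phi> = e + \<Phi> \<succ> \<beta>\<close>, one obtains \<open>\<Phi>(a\<^sub>1\<dots>a\<^sub>n)\<close> as the sum of \<open>R(a\<^sub>S) \<Psi>(gaps) \<Phi>(tail)\<close> over all \<open>S\<close> containing \<open>1\<close>,
  where the tail consists of the letters behind \<open>S\<close>. The c-free cumulants satisfy the same recursion:
  \<open>S\<close> is the block of \<open>1\<close>, which is outer, the blocks in its gaps are inner, and those in the tail
  are inner or outer independently of \<open>S\<close>.\<close>

section \<open>Splittings of a word\<close>

lemma conn_component_self: "i \<in> X \<Longrightarrow> i \<in> conn_component X i"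
  by (auto simp: conn_component_def)

lemma conn_component_subset: "conn_component X i \<subseteq> X"
  by (force simp: conn_component_def)

lemma conn_component_mono: "X \<subseteq> Y \<Longrightarrow> conn_component X i \<subseteq> conn_component Y i"
  by (auto simp: conn_component_def)

lemma conn_component_sym: "j \<in> conn_component X i \<longleftrightarrow> i \<in> conn_component X j"
  by (simp add: conn_component_def min.commute max.commute)

lemma conn_component_trans:
  assumes "j \<in> conn_component X i" "k \<in> conn_component X j"
  shows "k \<in> conn_component X i"
proof -
  have "{min i k..max i k} \<subseteq> {min i j..max i j} \<union> {min j k..max j k}"
    by (auto simp: min_def max_def)
  then show ?thesis
    using assms unfolding conn_component_def by blast
qed

lemma conn_component_eq: "j \<in> conn_component X i \<Longrightarrow> conn_component X j = conn_component X i"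
  using conn_component_trans conn_component_sym by blast

lemma Min_conn_component:
  assumes "finite X" "i \<in> X"
  shows "Min (conn_component X i) \<in> conn_component X i"
    and "conn_component X (Min (conn_component X i)) = conn_component X i"
proof -
  show *: "Min (conn_component X i) \<in> conn_component X i"
    using assms conn_component_self[of i X] finite_subset[OF conn_component_subset[of X i]]
    by (intro Min_in) auto
  show "conn_component X (Min (conn_component X i)) = conn_component X i"
    using conn_component_eq[OF *] .
qed

lemma set_components:
  assumes "finite X"
  shows "set (components X) = conn_component X ` X"
  using assms Min_conn_component(2)[OF assms] by (auto simp: components_def image_image)

lemma distinct_components:
  assumes "finite X"
  shows "distinct (components X)"
proof -
  have "inj_on (conn_component X) ((\<lambda>i. Min (conn_component X i)) ` X)"
    by (rule inj_onI) (use Min_conn_component(2)[OF assms] in auto)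
  then show ?thesis
    using assms by (simp add: components_def distinct_map)
qed

lemma sorted_list_of_set_snoc:
  assumes "finite A" "\<And>a. a \<in> A \<Longrightarrow> a < m"
  shows "sorted_list_of_set (insert m A) = sorted_list_of_set A @ [m]"
proof -
  have "A - {m} = A" using assms(2) by blast
  then show ?thesis
    using assms by (simp add: sorted_insort_is_snoc less_imp_le)
qed

text \<open>The selected position \<open>m - 1\<close> is a barrier that no run can cross; for
  \<open>m = 0\<close> there is nothing in front of the tail. The tail comes last in the list
  because its minimum \<open>m\<close> exceeds every other minimum.\<close>

lemma components_tail:
  fixes S :: "nat set"
  assumes "S \<subseteq> {..<m}" "m \<le> n" "m = 0 \<or> m - 1 \<in> S"
  shows "components ({..<n} - S) = components ({..<m} - S) @ (if m < n then [{m..<n}] else [])"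
proof (cases "m < n")
  case True
  let ?X = "{..<n} - S" and ?Y = "{..<m} - S"
  have lo: "conn_component ?X i = conn_component ?Y i" if "i \<in> ?Y" for i
  proof
    show "conn_component ?X i \<subseteq> conn_component ?Y i"
    proof
      fix j assume j: "j \<in> conn_component ?X i"
      have "m - 1 \<notin> {min i j..max i j}"
        using j assms(3) that unfolding conn_component_def by blast
      then have "max i j < m" using that by auto
      with j show "j \<in> conn_component ?Y i"
        unfolding conn_component_def by auto
    qed
    show "conn_component ?Y i \<subseteq> conn_component ?X i"
      by (rule conn_component_mono) (use assms(2) in auto)
  qed
  have hi: "conn_component ?X i = {m..<n}" if "i \<in> {m..<n}" for i
  proof
    show "conn_component ?X i \<subseteq> {m..<n}"
    proof
      fix j assume j: "j \<in> conn_component ?X i"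
      have "m = 0 \<or> m - 1 \<notin> {min i j..max i j}"
        using j assms(3) that unfolding conn_component_def by blast
      then have "m \<le> min i j" using that by auto
      moreover have "j < n" using j conn_component_subset by blast
      ultimately show "j \<in> {m..<n}" by auto
    qed
    show "{m..<n} \<subseteq> conn_component ?X i"
    proof
      fix j assume "j \<in> {m..<n}"
      then have "{min i j..max i j} \<subseteq> {m..<n}" using that by auto
      also have "\<dots> \<subseteq> ?X" using assms(1) by auto
      finally show "j \<in> conn_component ?X i" by (simp add: conn_component_def)
    qed
  qed
  have X: "?X = ?Y \<union> {m..<n}"
    using assms(1) True by auto
  let ?M = "(\<lambda>i. Min (conn_component ?Y i)) ` ?Y"
  have "(\<lambda>i. Min (conn_component ?X i)) ` ?X =
    (\<lambda>i. Min (conn_component ?X i)) ` ?Y \<union> (\<lambda>i. Min (conn_component ?X i)) ` {m..<n}"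
    by (subst X) (rule image_Un)
  also have "(\<lambda>i. Min (conn_component ?X i)) ` ?Y = ?M"
    by (rule image_cong) (simp_all only: lo)
  also have "(\<lambda>i. Min (conn_component ?X i)) ` {m..<n} = (\<lambda>i. m) ` {m..<n}"
  proof (rule image_cong)
    have "Min {m..<n} = m" by (rule Min_eqI) (use True in auto)
    then show "Min (conn_component ?X i) = m" if "i \<in> {m..<n}" for i
      by (simp only: hi[OF that])
  qed simp
  also have "\<dots> = {m}" using True by auto
  finally have M: "(\<lambda>i. Min (conn_component ?X i)) ` ?X = insert m ?M" by auto
  have MY: "?M \<subseteq> ?Y"
  proof
    fix j assume "j \<in> ?M"
    then obtain i where i: "i \<in> ?Y" "j = Min (conn_component ?Y i)" by blast
    show "j \<in> ?Y"
      using Min_conn_component(1)[of ?Y i] i conn_component_subset[of ?Y i] by auto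
  qed
  have "components ?X = map (conn_component ?X) (sorted_list_of_set ?M @ [m])"
    unfolding components_def M using MY by (subst sorted_list_of_set_snoc) auto
  also have "\<dots> = components ?Y @ [{m..<n}]"
  proof -
    have "map (conn_component ?X) (sorted_list_of_set ?M) = map (conn_component ?Y) (sorted_list_of_set ?M)"
      using MY by (intro map_cong) (auto intro!: lo)
    moreover have "conn_component ?X m = {m..<n}" by (rule hi) (use True in auto)
    ultimately show ?thesis by (simp only: components_def map_append list.map)
  qed
  finally show ?thesis using True by simp
next
  case False
  then show ?thesis using assms(2) by simp
qed

text \<open>The last run of unselected letters is kept apart from the others, because it is the only one
  that grows when a further unselected letter is appended to the word.\<close>

definition cut :: "nat set \<Rightarrow> nat" where
  "cut S = (if S = {} then 0 else Suc (Max S))"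

definition gaps :: "'a list \<Rightarrow> nat set \<Rightarrow> 'a barword" where
  "gaps as S = concat (map (\<lambda>J. bar (nths as J)) (components ({..<cut S} - S)))"

abbreviation (input) full :: "bool \<Rightarrow> bool" where
  "full \<equiv> \<lambda>_. True"

text \<open>The predicate \<open>P\<close> is applied to the truth value of ``the first letter is selected''; thus
  \<open>full\<close>, \<open>id\<close> and \<open>Not\<close> correspond to \<open>\<Delta>\<close>, \<open>\<Delta>\<^sub>\<prec>\<close> and \<open>\<Delta>\<^sub>\<succ>\<close>.\<close>

definition dsum ::
    "(bool \<Rightarrow> bool) \<Rightarrow> 'a list \<Rightarrow> ('a list \<Rightarrow> 'a barword \<Rightarrow> 'a list \<Rightarrow> 'b::comm_monoid_add) \<Rightarrow> 'b" where
  "dsum P as f =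
     (\<Sum>S \<in> {S. S \<subseteq> {..<length as} \<and> P (0 \<in> S)}. f (nths as S) (gaps as S) (drop (cut S) as))"

lemma cut_props:
  assumes "S \<subseteq> {..<n}"
  shows "S \<subseteq> {..<cut S}" "cut S \<le> n" "cut S = 0 \<or> cut S - 1 \<in> S"
proof -
  have fin: "finite S" using assms finite_subset by blast
  show "S \<subseteq> {..<cut S}" using fin by (auto simp: cut_def less_Suc_eq_le)
  show "cut S \<le> n" using fin assms by (auto simp: cut_def Suc_le_eq)
  show "cut S = 0 \<or> cut S - 1 \<in> S" using fin by (auto simp: cut_def)
qed

lemma components_empty [simp]: "components {} = []"
  by (simp add: components_def)

lemma components_cut:
  assumes "S \<subseteq> {..<n}"
  shows "components ({..<n} - S) =
    components ({..<cut S} - S) @ (if cut S < n then [{cut S..<n}] else [])"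
  by (rule components_tail) (use cut_props[OF assms] in auto)

lemma nths_atLeastLessThan: "nths as {k..<length as} = drop k as"
proof (cases "k \<le> length as")
  case True
  have "drop k as = nths (drop k as) {..<length as - k}"
    by (simp add: nths_all)
  also have "\<dots> = nths as {k..<length as}"
  proof -
    have "(+) k ` {..<length as - k} = {k..<length as}"
      using True image_add_atLeastLessThan[of k 0 "length as - k"] by (simp only: lessThan_atLeast0) simp
    then show ?thesis by (simp only: nths_drop)
  qed
  finally show ?thesis by simp
qed simp

lemma split_eq:
  assumes "S \<subseteq> {..<length as}"
  shows "split as S = (bar (nths as S), gaps as S @ bar (drop (cut S) as))"
  using cut_props(2)[OF assms]
  by (auto simp: split_def gaps_def components_cut[OF assms] nths_atLeastLessThan)

lemma nths_snoc:
  assumes "S \<subseteq> {..<length as}"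
  shows "nths (as @ [b]) S = nths as S"
  using assms by (auto simp: nths_append)

lemma dsum_Nil: "dsum P [] f = (if P False then f [] [] [] else 0)"
proof -
  have "{S::nat set. S \<subseteq> {..<length ([]::'a list)} \<and> P (0 \<in> S)} = (if P False then {{}} else {})"
    by auto
  then show ?thesis by (simp add: dsum_def gaps_def cut_def)
qed

text \<open>The recursion behind most inductions below. A selected last letter extends the subword
  and closes the pending run; an unselected one lengthens that run. The hypothesis excludes that the
  appended letter is itself the first one while \<open>P\<close> restricts the selection of the
  first letter.\<close>

lemma dsum_snoc:
  assumes "as \<noteq> [] \<or> P = full"
  shows "dsum P (as @ [b]) f =
    dsum P as (\<lambda>u v r. f (u @ [b]) (v @ bar r) []) + dsum P as (\<lambda>u v r. f u v (r @ [b]))"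
proof -
  let ?n = "length as"
  let ?A = "{S. S \<subseteq> {..<?n} \<and> P (0 \<in> S)}"
  let ?g = "\<lambda>S. f (nths (as @ [b]) S) (gaps (as @ [b]) S) (drop (cut S) (as @ [b]))"
  have P: "P (0 \<in> insert ?n S) = P (0 \<in> S)" for S
    using assms by auto
  have "{S. S \<subseteq> {..<length (as @ [b])} \<and> P (0 \<in> S)} = insert ?n ` ?A \<union> ?A"
  proof (intro equalityI subsetI)
    fix S assume S: "S \<in> {S. S \<subseteq> {..<length (as @ [b])} \<and> P (0 \<in> S)}"
    show "S \<in> insert ?n ` ?A \<union> ?A"
    proof (cases "?n \<in> S")
      case True
      then have "S = insert ?n (S - {?n})" by auto
      moreover have "S - {?n} \<in> ?A"
        using S P[of "S - {?n}"] True by (auto simp: insert_absorb less_Suc_eq)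
      ultimately show ?thesis by blast
    next
      case False
      then show ?thesis using S by (auto simp: less_Suc_eq)
    qed
  next
    fix S assume "S \<in> insert ?n ` ?A \<union> ?A"
    then show "S \<in> {S. S \<subseteq> {..<length (as @ [b])} \<and> P (0 \<in> S)}"
      using P by (auto simp: less_Suc_eq)
  qed
  moreover have "insert ?n ` ?A \<inter> ?A = {}" by auto
  moreover have fin: "finite ?A" by (rule finite_subset[of _ "Pow {..<?n}"]) auto
  ultimately have "dsum P (as @ [b]) f = sum ?g (insert ?n ` ?A) + sum ?g ?A"
    unfolding dsum_def by (simp add: sum.union_disjoint)
  also have "sum ?g (insert ?n ` ?A) = (\<Sum>S\<in>?A. ?g (insert ?n S))"
  proof -
    have "inj_on (insert ?n) ?A"
      by (rule inj_onI) (metis (no_types, lifting) Diff_insert_absorb mem_Collect_eq lessThan_iff less_irrefl subsetD)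
    then show ?thesis by (simp add: sum.reindex)
  qed
  also have "\<dots> = dsum P as (\<lambda>u v r. f (u @ [b]) (v @ bar r) [])"
    unfolding dsum_def
  proof (rule sum.cong[OF refl])
    fix S assume "S \<in> ?A"
    then have S: "S \<subseteq> {..<?n}" by simp
    have finS: "finite S" using S finite_subset by blast
    have "Max (insert ?n S) = ?n"
      using S finS by (intro Max_eqI) auto
    then have c: "cut (insert ?n S) = Suc ?n" by (simp add: cut_def)
    have "{..<Suc ?n} - insert ?n S = {..<?n} - S" by auto
    moreover have "set (components ({..<?n} - S)) \<subseteq> Pow {..<?n}"
      using conn_component_subset by (fastforce simp: set_components)
    \<comment> \<open>Once the appended letter is selected, every run of the old word is complete,
      so the gaps are the entire right factor of \<open>split as S\<close>.\<close>
    ultimately have "gaps (as @ [b]) (insert ?n S) = snd (split as S)"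
      unfolding gaps_def c split_def by (auto intro!: arg_cong[of _ _ concat] simp: nths_snoc subset_iff)
    then have "gaps (as @ [b]) (insert ?n S) = gaps as S @ bar (drop (cut S) as)"
      using split_eq[OF S] by simp
    moreover have "nths (as @ [b]) (insert ?n S) = nths as S @ [b]"
    proof -
      have "nths as (insert ?n S) = nths as S"
        unfolding nths_def by (intro arg_cong[of _ _ "map fst"] filter_cong) (auto dest: set_zip_rightD)
      then show ?thesis by (simp add: nths_append)
    qed
    ultimately show "?g (insert ?n S) = f (nths as S @ [b]) (gaps as S @ bar (drop (cut S) as)) []"
      using c by simp
  qed
  also have "sum ?g ?A = dsum P as (\<lambda>u v r. f u v (r @ [b]))"
    unfolding dsum_def
  proof (rule sum.cong[OF refl])
    fix S assume "S \<in> ?A"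
    then have S: "S \<subseteq> {..<?n}" by simp
    have "set (components ({..<cut S} - S)) \<subseteq> Pow {..<cut S}"
      using conn_component_subset by (fastforce simp: set_components)
    then have "set (components ({..<cut S} - S)) \<subseteq> Pow {..<?n}"
      using cut_props(2)[OF S] by fastforce
    then have "gaps (as @ [b]) S = gaps as S"
      unfolding gaps_def by (auto intro!: arg_cong[of _ _ concat] simp: nths_snoc subset_iff)
    then show "?g S = f (nths as S) (gaps as S) (drop (cut S) as @ [b])"
      using cut_props(2)[OF S] by (simp add: nths_snoc[OF S])
  qed
  finally show ?thesis .
qed

lemma dsum_single:
  "dsum P [a] f = (if P True then f [a] [] [] else 0) + (if P False then f [] [] [a] else 0)"
proof -
  have "{S. S \<subseteq> {..<length [a]} \<and> P (0 \<in> S)} =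
    (if P True then {{0}} else {}) \<union> (if P False then {{}} else {})"
    by (auto simp: subset_singleton_iff lessThan_Suc)
  moreover have "cut {0} = 1" "cut {} = 0" by (auto simp: cut_def)
  ultimately show ?thesis
    by (auto simp: dsum_def gaps_def add.commute lessThan_Suc)
qed

section \<open>Coassociativity\<close>

lemma dsum_add: "dsum P as (\<lambda>u v r. f u v r + g u v r) = dsum P as f + dsum P as g"
  by (simp add: dsum_def sum.distrib)

lemma dsum_0 [simp]: "dsum P as (\<lambda>u v r. 0) = 0"
  by (simp add: dsum_def)

lemma dsum_mult_left: "c * dsum P as f = dsum P as (\<lambda>u v r. c * f u v r)" for c :: "'b::comm_ring_1"
  by (simp add: dsum_def sum_distrib_left)

lemma dsum_mult_right: "dsum P as f * c = dsum P as (\<lambda>u v r. f u v r * c)" for c :: "'b::comm_ring_1"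
  by (simp add: dsum_def sum_distrib_right)

lemma dsum_swap:
  "dsum P as (\<lambda>u v r. dsum Q bs (f u v r)) = dsum Q bs (\<lambda>u' v' r'. dsum P as (\<lambda>u v r. f u v r u' v' r'))"
  unfolding dsum_def by (rule sum.swap)

text \<open>Here the first letter is always selected, so identities that require a non-empty subword
  may be applied under the sum.\<close>

lemma dsum_left_cong:
  assumes "\<And>u v r. u \<noteq> [] \<Longrightarrow> f u v r = g u v r"
  shows "dsum id as f = dsum id as g"
  unfolding dsum_def
proof (rule sum.cong[OF refl])
  fix S assume "S \<in> {S. S \<subseteq> {..<length as} \<and> id (0 \<in> S)}"
  then have "as ! 0 \<in> set (nths as S)" by (auto simp: set_nths)
  then have "nths as S \<noteq> []" by (metis empty_iff list.set(1))
  then show "f (nths as S) (gaps as S) (drop (cut S) as) = g (nths as S) (gaps as S) (drop (cut S) as)"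
    using assms by auto
qed

lemma bar_eq_Nil_iff [simp]: "bar as = [] \<longleftrightarrow> as = []"
  by (cases as) auto

text \<open>The unselected first letter lies in a completed run or in the pending one, so no
  splitting has both parts empty.\<close>

lemma dsum_right_nonempty:
  assumes "as \<noteq> []"
  shows "dsum Not as (\<lambda>u v r. if v = [] \<and> r = [] then f u v r else 0) = 0"
  using assms
proof (induction as arbitrary: f rule: rev_nonempty_induct)
  case (single x)
  then show ?case by (simp add: dsum_single)
next
  case (snoc x xs)
  then show ?case by (simp add: dsum_snoc)
qed

lemma dsum_right_cong:
  assumes "as \<noteq> []" "\<And>u v r. v \<noteq> [] \<or> r \<noteq> [] \<Longrightarrow> f u v r = g u v r"
  shows "dsum Not as f = dsum Not as g"
proof -
  \<comment> \<open>The values lie in a mere commutative monoid, so the part with empty right factor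
    is split off by addition and then seen to vanish.\<close>
  have *: "dsum Not as f = dsum Not as (\<lambda>u v r. if v = [] \<and> r = [] then 0 else f u v r)" for f
  proof -
    have "dsum Not as f = dsum Not as (\<lambda>u v r. (if v = [] \<and> r = [] then f u v r else 0) +
        (if v = [] \<and> r = [] then 0 else f u v r))"
      by (rule arg_cong[of _ _ "dsum Not as"]) (auto simp: fun_eq_iff)
    then show ?thesis
      by (simp only: dsum_add dsum_right_nonempty[OF assms(1)] add_0)
  qed
  have "(\<lambda>u v r. if v = [] \<and> r = [] then 0 else f u v r) = (\<lambda>u v r. if v = [] \<and> r = [] then 0 else g u v r)"
    using assms(2) by (auto simp: fun_eq_iff)
  then show ?thesis by (simp only: *[of f] *[of g])
qed

text \<open>Any letter selected after the unselected first one would complete a run. Only the empty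
  selection remains, with the whole word pending.\<close>

lemma dsum_right_no_gap:
  assumes "as \<noteq> []"
  shows "dsum Not as (\<lambda>u v r. if v = [] then f u v r else 0) = f [] [] as"
  using assms
proof (induction as arbitrary: f rule: rev_nonempty_induct)
  case (single x)
  then show ?case by (simp add: dsum_single)
next
  case (snoc x xs)
  have "dsum Not xs (\<lambda>u v r. if v = [] \<and> r = [] then f (u @ [x]) (v @ bar r) [] else 0) = 0"
    using snoc.hyps by (rule dsum_right_nonempty)
  moreover have "(\<lambda>u v r. if v @ bar r = [] then f (u @ [x]) (v @ bar r) [] else 0) =
      (\<lambda>u v r. if v = [] \<and> r = [] then f (u @ [x]) (v @ bar r) [] else 0)"
    by (auto simp: fun_eq_iff)
  ultimately show ?case
    using snoc by (simp add: dsum_snoc)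
qed

lemma dsum_empty_left:
  assumes "P False" "as \<noteq> [] \<or> P = full"
  shows "dsum P as (\<lambda>u v r. if u = [] then f u v r else 0) = f [] [] as"
proof (cases "as = []")
  case False
  then show ?thesis
    using assms
    by (induction as arbitrary: f rule: rev_nonempty_induct) (simp_all add: dsum_single dsum_snoc)
qed (use assms in \<open>simp add: dsum_Nil\<close>)

lemma dsum_cong_length:
  assumes "\<And>u v r. length u \<le> length as \<Longrightarrow> f u v r = g u v r"
  shows "dsum P as f = dsum P as g"
  unfolding dsum_def
proof (rule sum.cong[OF refl])
  fix S
  have "length (nths as S) \<le> length as"
    by (simp add: length_nths) (metis (no_types, lifting) card_mono finite_lessThan card_lessThan mem_Collect_eq lessThan_iff subsetI)
  then show "f (nths as S) (gaps as S) (drop (cut S) as) = g (nths as S) (gaps as S) (drop (cut S) as)"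
    by (rule assms)
qed

text \<open>Isolates the selection of all letters; the other terms have shorter subwords. This makes
  the equations for the convolution inverse and for the cumulants triangular.\<close>

lemma dsum_all_left:
  assumes "P True" "as \<noteq> []"
  shows "dsum P as f = f as [] [] + dsum P as (\<lambda>u v r. if length u < length as then f u v r else 0)"
  using assms(2)
proof (induction as arbitrary: f rule: rev_nonempty_induct)
  case (single x)
  then show ?case using assms(1) by (simp add: dsum_single)
next
  case (snoc x xs)
  have "dsum P xs (\<lambda>u v r. f u v (r @ [x])) =
    dsum P xs (\<lambda>u v r. if length u < length (xs @ [x]) then f u v (r @ [x]) else 0)"
    by (rule dsum_cong_length) simp
  then show ?case
    using snoc.hyps
    by (simp add: dsum_snoc snoc.IH[of "\<lambda>u v r. f (u @ [x]) (v @ bar r) []"] add.assoc)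
qed

text \<open>The value at \<open>[]\<close> is that of \<open>\<Delta>\<close> for \<open>P = full\<close> and makes the half coproducts vanish at the unit.\<close>

fun csum ::
    "(bool \<Rightarrow> bool) \<Rightarrow> 'a barword \<Rightarrow> ('a barword \<Rightarrow> 'a barword \<Rightarrow> 'b::comm_monoid_add) \<Rightarrow> 'b" where
  "csum P [] f = (if P True \<and> P False then f [] [] else 0)"
| "csum P (w # ws) f =
     dsum P (letters w) (\<lambda>u v r. csum full ws (\<lambda>u' v'. f (bar u @ u') (v @ bar r @ v')))"

lemma letters_nonempty [simp]: "letters w \<noteq> []"
  by (simp add: letters_def)

section \<open>Coproducts as iterated sums\<close>

lemma sum_tensor_mult:
  "(\<Sum>(u, v)\<in>#tensor_mult M N. f u v) =
    (\<Sum>(u, v)\<in>#M. \<Sum>(u', v')\<in>#N. f (u @ u') (v @ v'))"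
  unfolding tensor_mult_def
  by (induction M) (auto simp: case_prod_beta multiset.map_comp comp_def)

text \<open>Instantiating \<open>P\<close> by \<open>full\<close>, \<open>id\<close> and
  \<open>Not\<close> covers the coproduct and both half coproducts at once.\<close>

lemma sum_coprod_word:
  "(\<Sum>(u, v)\<in>#image_mset (split (letters w))
        (mset_set {S. S \<subseteq> {..<length (letters w)} \<and> P (0 \<in> S)}). f u v) =
    dsum P (letters w) (\<lambda>u v r. f (bar u) (v @ bar r))"
proof -
  have "(\<Sum>(u, v)\<in>#image_mset (split (letters w))
        (mset_set {S. S \<subseteq> {..<length (letters w)} \<and> P (0 \<in> S)}). f u v) =
    (\<Sum>S\<in>{S. S \<subseteq> {..<length (letters w)} \<and> P (0 \<in> S)}. case split (letters w) S of (u, v) \<Rightarrow> f u v)"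
    by (simp add: sum_unfold_sum_mset multiset.map_comp comp_def)
  also have "\<dots> = dsum P (letters w) (\<lambda>u v r. f (bar u) (v @ bar r))"
    unfolding dsum_def by (intro sum.cong[OF refl]) (simp add: split_eq)
  finally show ?thesis .
qed

lemma sum_coprod: "(\<Sum>(u, v)\<in>#coprod ws. f u v) = csum full ws f"
proof (induction ws arbitrary: f)
  case (Cons w ws)
  then show ?case
    by (simp add: sum_tensor_mult coprod_word_def sum_coprod_word[where P = full, simplified])
qed simp

lemma sum_coprod_left: "(\<Sum>(u, v)\<in>#coprod_left ws. f u v) = csum id ws f"
proof (cases ws)
  case (Cons w ws)
  then show ?thesis
    by (simp add: sum_tensor_mult coprod_left_word_def sum_coprod sum_coprod_word[where P = id, simplified])
qed simp

lemma sum_coprod_right: "(\<Sum>(u, v)\<in>#coprod_right ws. f u v) = csum Not ws f"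
proof (cases ws)
  case (Cons w ws)
  then show ?thesis
    by (simp add: sum_tensor_mult coprod_right_word_def sum_coprod sum_coprod_word[where P = Not, simplified])
qed simp

lemma csum_add: "csum P ws (\<lambda>u v. f u v + g u v) = csum P ws f + csum P ws g"
  by (induction P ws f arbitrary: g rule: csum.induct) (simp_all add: dsum_add)

lemma csum_0 [simp]: "csum P ws (\<lambda>u v. 0) = 0"
  by (induction ws arbitrary: P) simp_all

lemma csum_dsum_swap:
  "csum P ws (\<lambda>u v. dsum Q as (f u v)) = dsum Q as (\<lambda>u' v' r'. csum P ws (\<lambda>u v. f u v u' v' r'))"
proof (induction ws arbitrary: P f)
  case (Cons w ws)
  show ?case by (simp add: Cons.IH dsum_swap[of P])
next
  case Nil
  show ?case by (cases "P True \<and> P False") auto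
qed

lemma csum_swap:
  "csum P ws (\<lambda>u v. csum Q ws' (f u v)) = csum Q ws' (\<lambda>u' v'. csum P ws (\<lambda>u v. f u v u' v'))"
proof (induction ws arbitrary: P f)
  case (Cons w ws)
  show ?case by (simp add: Cons.IH csum_dsum_swap)
next
  case Nil
  show ?case by (cases "P True \<and> P False") auto
qed

text \<open>\<open>P\<close> restricts only the first word of the list, which must therefore belong
  to \<open>x\<close>; without a restriction \<open>x\<close> may be empty.\<close>

lemma csum_append:
  assumes "x \<noteq> [] \<or> P = full"
  shows "csum P (x @ y) f = csum P x (\<lambda>u v. csum full y (\<lambda>u' v'. f (u @ u') (v @ v')))"
  using assms
proof (induction x arbitrary: P f)
  case (Cons w x)
  then show ?case by simp
qed auto

lemma letters_bar: "as \<noteq> [] \<Longrightarrow> \<exists>w. bar as = [w] \<and> letters w = as"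
  by (cases as) (auto simp: letters_def)

lemma csum_bar:
  assumes "p \<noteq> [] \<or> P = full"
  shows "csum P (bar p) g = dsum P p (\<lambda>u v r. g (bar u) (v @ bar r))"
proof (cases "p = []")
  case False
  then obtain w where "bar p = [w]" "letters w = p" using letters_bar by blast
  then show ?thesis by simp
qed (use assms in \<open>simp add: dsum_Nil\<close>)

text \<open>The right-hand side of coassociativity: the bar word \<open>y\<close> consists of the completed runs of the
  outer splitting, and \<open>p\<close> is its pending last run; both are split again.\<close>

definition split_runs ::
    "(bool \<Rightarrow> bool) \<Rightarrow> 'a barword \<Rightarrow> 'a list
      \<Rightarrow> ('a barword \<Rightarrow> 'a list \<Rightarrow> 'a barword \<Rightarrow> 'a list \<Rightarrow> 'b::comm_monoid_add) \<Rightarrow> 'b" where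
  "split_runs P y p g =
    (if y = [] then dsum P p (\<lambda>q v r. g [] q v r)
     else csum P y (\<lambda>m v. dsum full p (\<lambda>q v' r. g m q (v @ v') r)))"

text \<open>Only the pending run grows, so this is \<open>dsum_snoc\<close> for \<open>p\<close>.
  The hypothesis again keeps the new letter from being a first letter subject to
  \<open>P\<close>.\<close>

lemma split_runs_extend:
  assumes "y \<noteq> [] \<or> p \<noteq> [] \<or> P = full"
  shows "split_runs P y (p @ [b]) g =
    split_runs P y p (\<lambda>m q v r. g m (q @ [b]) (v @ bar r) []) +
    split_runs P y p (\<lambda>m q v r. g m q v (r @ [b]))"
proof (cases "y = []")
  case True
  then show ?thesis using assms by (simp add: split_runs_def dsum_snoc)
next
  case False
  then show ?thesis by (simp add: split_runs_def dsum_snoc csum_add)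
qed

lemma csum_runs:
  assumes "y \<noteq> [] \<or> p \<noteq> [] \<or> P = full"
  shows "csum P (y @ bar p) g = split_runs P y p (\<lambda>m q v r. g (m @ bar q) (v @ bar r))"
proof (cases "y = []")
  case True
  then show ?thesis using assms by (simp add: split_runs_def csum_bar)
next
  case False
  then show ?thesis by (simp add: split_runs_def csum_append csum_bar)
qed

text \<open>When the outer run is closed, \<open>bar p\<close> joins the completed words, and the
  pending pieces \<open>q\<close> and \<open>r\<close> of the inner splitting are closed with
  it.\<close>

lemma split_runs_close:
  assumes "y \<noteq> [] \<or> p \<noteq> [] \<or> P = full"
  shows "split_runs P (y @ bar p) [] g =
    split_runs P y p (\<lambda>m q v r. g (m @ bar q) [] (v @ bar r) [])"
proof (cases "y = [] \<and> p = []")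
  case True
  then show ?thesis using assms by (simp add: split_runs_def dsum_Nil)
next
  case False
  then have "split_runs P (y @ bar p) [] g = csum P (y @ bar p) (\<lambda>m v. g m [] v [])"
    by (auto simp: split_runs_def dsum_Nil)
  also have "\<dots> = split_runs P y p (\<lambda>m q v r. g (m @ bar q) [] (v @ bar r) [])"
    using assms by (rule csum_runs)
  finally show ?thesis .
qed

text \<open>The four cases are indexed by the tensor factor that receives the first letter (the first, the
  second, the third, or any).\<close>

inductive coassoc_case :: "(bool \<Rightarrow> bool) \<Rightarrow> (bool \<Rightarrow> bool) \<Rightarrow> (bool \<Rightarrow> bool) \<Rightarrow> (bool \<Rightarrow> bool) \<Rightarrow> bool" where
  "coassoc_case id id id full"
| "coassoc_case id Not Not id"
| "coassoc_case Not full Not Not"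
| "coassoc_case full full full full"

text \<open>Whenever \<open>Q\<close> restricts the inner splitting, \<open>P\<close> is
  \<open>id\<close> and the subword to be split again is non-empty. This supplies the side
  conditions of \<open>dsum_snoc\<close> and \<open>csum_append\<close>; the next lemma does the
  same on the right, with \<open>Not\<close> for \<open>id\<close>.\<close>

lemma coassoc_case_left_cong:
  assumes "coassoc_case P Q P' Q'" "\<And>u v r. u \<noteq> [] \<or> Q = full \<Longrightarrow> f u v r = g u v r"
  shows "dsum P as f = dsum P as g"
proof (cases "P = id")
  case True
  then show ?thesis using dsum_left_cong[of f g as] assms(2) by blast
next
  case False
  then have "Q = full" using assms(1) by (auto elim: coassoc_case.cases)
  then have "f = g" using assms(2) by (intro ext) blast
  then show ?thesis by (simp only:)
qed

lemma coassoc_case_right_cong: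
  assumes "coassoc_case P Q P' Q'" "as \<noteq> []"
    "\<And>u v r. v \<noteq> [] \<or> r \<noteq> [] \<or> Q' = full \<Longrightarrow> f u v r = g u v r"
  shows "dsum P' as f = dsum P' as g"
proof (cases "P' = Not")
  case True
  then show ?thesis using dsum_right_cong[OF assms(2), of f g] assms(3) by blast
next
  case False
  then have "Q' = full" using assms(1) by (auto elim: coassoc_case.cases)
  then have "f = g" using assms(3) by (intro ext) blast
  then show ?thesis by (simp only:)
qed

text \<open>The last letter goes to one of three factors. In the first it closes the pending runs of
  the other two, in the second it closes that of the third, and in the third it only lengthens a
  run. Both iterated splittings decompose into these three sums \<open>?G1\<close>,
  \<open>?G2\<close>, \<open>?G3\<close>.\<close>

lemma dsum_coassoc:
  fixes G :: "'a list \<Rightarrow> 'a barword \<Rightarrow> 'a list \<Rightarrow> 'a barword \<Rightarrow> 'a list \<Rightarrow> 'b::comm_monoid_add"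
  assumes "coassoc_case P Q P' Q'" "as \<noteq> []"
  shows "dsum P as (\<lambda>x v r. dsum Q x (\<lambda>u m q. G u m q v r)) =
    dsum P' as (\<lambda>u y p. split_runs Q' y p (\<lambda>m q v r. G u m q v r))"
  using assms(2)
proof (induction as arbitrary: G rule: rev_nonempty_induct)
  case (single a)
  show ?case
    using assms(1) by cases (simp_all add: dsum_single dsum_Nil split_runs_def add.assoc)
next
  case (snoc b as)
  let ?G1 = "\<lambda>u m q v r. G (u @ [b]) (m @ bar q) [] (v @ bar r) []"
  let ?G2 = "\<lambda>u m q v r. G u m (q @ [b]) (v @ bar r) []"
  let ?G3 = "\<lambda>u m q v r. G u m q v (r @ [b])"
  have "dsum P (as @ [b]) (\<lambda>x v r. dsum Q x (\<lambda>u m q. G u m q v r)) =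
    dsum P as (\<lambda>x v r. dsum Q (x @ [b]) (\<lambda>u m q. G u m q (v @ bar r) [])) +
    dsum P as (\<lambda>x v r. dsum Q x (\<lambda>u m q. ?G3 u m q v r))"
    using snoc.hyps by (simp add: dsum_snoc)
  also have "dsum P as (\<lambda>x v r. dsum Q (x @ [b]) (\<lambda>u m q. G u m q (v @ bar r) [])) =
    dsum P as (\<lambda>x v r. dsum Q x (\<lambda>u m q. ?G1 u m q v r) + dsum Q x (\<lambda>u m q. ?G2 u m q v r))"
    by (rule coassoc_case_left_cong[OF assms(1)]) (simp add: dsum_snoc)
  also have "\<dots> = dsum P' as (\<lambda>u y p. split_runs Q' y p (\<lambda>m q v r. ?G1 u m q v r)) +
      dsum P' as (\<lambda>u y p. split_runs Q' y p (\<lambda>m q v r. ?G2 u m q v r))"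
    by (simp only: dsum_add snoc.IH)
  also have "dsum P as (\<lambda>x v r. dsum Q x (\<lambda>u m q. ?G3 u m q v r)) =
      dsum P' as (\<lambda>u y p. split_runs Q' y p (\<lambda>m q v r. ?G3 u m q v r))"
    by (rule snoc.IH)
  finally have L: "dsum P (as @ [b]) (\<lambda>x v r. dsum Q x (\<lambda>u m q. G u m q v r)) =
    dsum P' as (\<lambda>u y p. split_runs Q' y p (\<lambda>m q v r. ?G1 u m q v r)) +
    (dsum P' as (\<lambda>u y p. split_runs Q' y p (\<lambda>m q v r. ?G2 u m q v r)) +
     dsum P' as (\<lambda>u y p. split_runs Q' y p (\<lambda>m q v r. ?G3 u m q v r)))"
    by (simp only: add.assoc)
  have "dsum P' (as @ [b]) (\<lambda>u y p. split_runs Q' y p (\<lambda>m q v r. G u m q v r)) =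
    dsum P' as (\<lambda>u y p. split_runs Q' (y @ bar p) [] (\<lambda>m q v r. G (u @ [b]) m q v r)) +
    dsum P' as (\<lambda>u y p. split_runs Q' y (p @ [b]) (\<lambda>m q v r. G u m q v r))"
    using snoc.hyps by (simp add: dsum_snoc)
  also have "dsum P' as (\<lambda>u y p. split_runs Q' (y @ bar p) [] (\<lambda>m q v r. G (u @ [b]) m q v r)) =
      dsum P' as (\<lambda>u y p. split_runs Q' y p (\<lambda>m q v r. ?G1 u m q v r))"
    by (rule coassoc_case_right_cong[OF assms(1) snoc.hyps]) (rule split_runs_close)
  also have "dsum P' as (\<lambda>u y p. split_runs Q' y (p @ [b]) (\<lambda>m q v r. G u m q v r)) =
    dsum P' as (\<lambda>u y p. split_runs Q' y p (\<lambda>m q v r. ?G2 u m q v r) +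
      split_runs Q' y p (\<lambda>m q v r. ?G3 u m q v r))"
    by (rule coassoc_case_right_cong[OF assms(1) snoc.hyps]) (rule split_runs_extend)
  finally show ?case by (simp only: L dsum_add)
qed

lemma csum_split_runs_swap:
  "csum P ws (\<lambda>u v. split_runs Q y p (g u v)) =
    split_runs Q y p (\<lambda>m q v' r. csum P ws (\<lambda>u v. g u v m q v' r))"
  by (simp add: split_runs_def csum_dsum_swap csum_swap[of P])

lemma csum_coassoc:
  fixes F :: "'a barword \<Rightarrow> 'a barword \<Rightarrow> 'a barword \<Rightarrow> 'b::comm_monoid_add"
  assumes "coassoc_case P Q P' Q'"
  shows "csum P ws (\<lambda>x v. csum Q x (\<lambda>u m. F u m v)) = csum P' ws (\<lambda>u y. csum Q' y (\<lambda>m v. F u m v))"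
  using assms
proof (induction ws arbitrary: P Q P' Q' F)
  case Nil
  then show ?case by cases auto
next
  case (Cons w ws)
  let ?as = "letters w"
  \<comment> \<open>\<open>G\<close> absorbs the words after the first one. These carry no
    restriction, so the unrestricted case of the induction hypothesis gives its second form
    \<open>G'\<close>, suited to the right-hand side.\<close>
  define G where "G = (\<lambda>u m q v r. csum full ws (\<lambda>x' v'. csum full x' (\<lambda>u' m'.
    F (bar u @ u') (m @ bar q @ m') (v @ bar r @ v'))))"
  have G': "G u m q v r = csum full ws (\<lambda>u' y'. csum full y' (\<lambda>m' v'.
    F (bar u @ u') (m @ bar q @ m') (v @ bar r @ v')))" for u m q v r
    unfolding G_def by (rule Cons.IH) (rule coassoc_case.intros)
  have "csum P (w # ws) (\<lambda>x v. csum Q x (\<lambda>u m. F u m v)) =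
    dsum P ?as (\<lambda>x v r. dsum Q x (\<lambda>u m q. G u m q v r))"
    unfolding csum.simps
  proof (rule coassoc_case_left_cong[OF Cons.prems])
    fix x :: "'a list" and v r
    assume x: "x \<noteq> [] \<or> Q = full"
    then have "csum Q (bar x @ x') f =
        dsum Q x (\<lambda>u m q. csum full x' (\<lambda>u' m'. f (bar u @ u') (m @ bar q @ m')))"
      for x' and f :: "_ \<Rightarrow> _ \<Rightarrow> 'b"
      by (simp add: csum_append csum_bar)
    then show "csum full ws (\<lambda>x' v'. csum Q (bar x @ x') (\<lambda>u m. F u m (v @ bar r @ v'))) =
        dsum Q x (\<lambda>u m q. G u m q v r)"
      by (simp add: csum_dsum_swap G_def)
  qed
  also have "\<dots> = dsum P' ?as (\<lambda>u y p. split_runs Q' y p (\<lambda>m q v r. G u m q v r))"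
    using Cons.prems by (rule dsum_coassoc) simp
  also have "\<dots> = csum P' (w # ws) (\<lambda>u y. csum Q' y (\<lambda>m v. F u m v))"
    unfolding csum.simps
  proof (rule coassoc_case_right_cong[OF Cons.prems letters_nonempty])
    fix u :: "'a list" and y :: "'a barword" and p :: "'a list"
    assume yp: "y \<noteq> [] \<or> p \<noteq> [] \<or> Q' = full"
    have "csum Q' (y @ bar p @ y') f = split_runs Q' y p (\<lambda>m q v r.
        csum full y' (\<lambda>m' v'. f (m @ bar q @ m') (v @ bar r @ v')))"
      for y' and f :: "_ \<Rightarrow> _ \<Rightarrow> 'b"
      using csum_append[of "y @ bar p" Q' y' f] yp
      by (simp add: csum_runs)
    then show "split_runs Q' y p (\<lambda>m q v r. G u m q v r) =
      csum full ws (\<lambda>u' y'. csum Q' (y @ bar p @ y') (\<lambda>m v. F (bar u @ u') m v))"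
      by (simp add: csum_split_runs_swap G')
  qed
  finally show ?case .
qed

section \<open>The convolution algebra and its bimodules\<close>

lemma csum_mult_left: "c * csum P ws f = csum P ws (\<lambda>u v. c * f u v)" for c :: "'k::field"
  by (induction ws arbitrary: P f) (simp_all add: dsum_mult_left)

lemma csum_mult_right: "csum P ws f * c = csum P ws (\<lambda>u v. f u v * c)" for c :: "'k::field"
  by (induction ws arbitrary: P f) (simp_all add: dsum_mult_right)

lemma bar_letters [simp]: "bar (letters w) = [w]"
  by (simp add: letters_def)

lemma dsum_empty_right:
  assumes "P True" "as \<noteq> []"
  shows "dsum P as (\<lambda>u v r. if v = [] \<and> r = [] then f u else 0) = f as"
  using assms(2)
proof (induction as arbitrary: f rule: rev_nonempty_induct)
  case (single x)
  then show ?case using assms(1) by (simp add: dsum_single)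
next
  case (snoc x xs)
  then show ?case by (simp add: dsum_snoc)
qed

text \<open>Only the selection of all letters leaves an empty right factor. For \<open>full\<close>
  this yields the counit law, for \<open>id\<close> it recovers the term removed in the reduced half
  coproduct.\<close>

lemma csum_empty_right:
  assumes "P True" "ws \<noteq> [] \<or> P = full"
  shows "csum P ws (\<lambda>u v. if v = [] then f u else 0) = f ws"
  using assms
proof (induction ws arbitrary: P f)
  case (Cons w ws)
  have "csum full ws (\<lambda>u' v'. if v @ bar r @ v' = [] then f (bar u @ u') else 0) =
      (if v = [] \<and> r = [] then f (bar u @ ws) else 0)" for u v r
    using Cons.IH[of full "\<lambda>u'. f (bar u @ u')"] by auto
  then show ?case
    using Cons.prems by (simp add: dsum_empty_right)
qed auto

lemma csum_empty_left:
  assumes "P False" "ws \<noteq> [] \<or> P = full"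
  shows "csum P ws (\<lambda>u v. if u = [] then f v else 0) = f ws"
  using assms
proof (induction ws arbitrary: P f)
  case (Cons w ws)
  have "csum full ws (\<lambda>u' v'. if bar u @ u' = [] then f (v @ bar r @ v') else 0) =
      (if u = [] then f (v @ bar r @ ws) else 0)" for u :: "'a list" and v r
    using Cons.IH[of full "\<lambda>v'. f (v @ bar r @ v')"] by auto
  then show ?case
    using Cons.prems by (simp add: dsum_empty_left)
qed auto

lemma conv_eq: "conv \<Gamma> \<Lambda> ws = csum full ws (\<lambda>u v. \<Gamma> u * \<Lambda> v)"
  unfolding conv_def by (rule sum_coprod)

lemma conv_assoc: "conv (conv \<Gamma> \<Lambda>) \<Theta> = conv \<Gamma> (conv \<Lambda> \<Theta>)"
proof
  fix ws
  show "conv (conv \<Gamma> \<Lambda>) \<Theta> ws = conv \<Gamma> (conv \<Lambda> \<Theta>) ws"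
    using csum_coassoc[OF coassoc_case.intros(4), of ws "\<lambda>u m v. \<Gamma> u * \<Lambda> m * \<Theta> v"]
    by (simp add: conv_eq csum_mult_left csum_mult_right mult.assoc)
qed

lemma conv_counit_right [simp]: "conv \<Gamma> counit = \<Gamma>"
proof
  fix ws
  have "csum full ws (\<lambda>u v. \<Gamma> u * counit v) = csum full ws (\<lambda>u v. if v = [] then \<Gamma> u else 0)"
    by (rule arg_cong[of _ _ "csum full ws"]) (auto simp: counit_def fun_eq_iff)
  then show "conv \<Gamma> counit ws = \<Gamma> ws"
    by (simp add: conv_eq csum_empty_right)
qed

lemma conv_counit_left [simp]: "conv counit \<Gamma> = \<Gamma>"
proof
  fix ws
  have "csum full ws (\<lambda>u v. counit u * \<Gamma> v) = csum full ws (\<lambda>u v. if u = [] then \<Gamma> v else 0)"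
    by (rule arg_cong[of _ _ "csum full ws"]) (auto simp: counit_def fun_eq_iff)
  then show "conv counit \<Gamma> ws = \<Gamma> ws"
    by (simp add: conv_eq csum_empty_left)
qed

text \<open>The pair removed in a reduced half coproduct has weight 0, because
  \<open>plus_part\<close> vanishes at the unit.\<close>

lemma sum_mset_minus_zero:
  fixes g :: "'b \<Rightarrow> 'k::ab_group_add"
  assumes "g x = 0"
  shows "(\<Sum>y\<in>#M - {#x#}. g y) = (\<Sum>y\<in>#M. g y)"
proof (cases "x \<in># M")
  case True
  then have "(\<Sum>y\<in>#M. g y) = (\<Sum>y\<in>#add_mset x (M - {#x#}). g y)" by simp
  then show ?thesis using assms by simp
qed (simp add: diff_single_trivial)

text \<open>The extension by \<open>e\<close> on the right adds \<open>X ws * \<Lambda> []\<close>,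
  exactly the contribution of the removed pair \<open>(ws, [])\<close>, so reduced product and
  extension recombine into the full half coproduct.\<close>

lemma half_left_eq:
  assumes "X [] = 0"
  shows "(X \<prec> \<Lambda>) ws = csum id ws (\<lambda>u v. X u * \<Lambda> v)"
proof (cases "ws = []")
  case True
  then show ?thesis by (simp add: half_left_def coprod_left_plus_def plus_part_def)
next
  case False
  have X: "plus_part X = X" using assms by (auto simp: plus_part_def)
  have "(X \<prec> \<Lambda>) ws = csum id ws (\<lambda>u v. X u * plus_part \<Lambda> v) + X ws * \<Lambda> []"
    unfolding half_left_def coprod_left_plus_def X
    by (subst sum_mset_minus_zero) (simp_all add: plus_part_def sum_coprod_left)
  also have "X ws * \<Lambda> [] = csum id ws (\<lambda>u v. if v = [] then X u * \<Lambda> [] else 0)"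
    using False by (subst csum_empty_right) auto
  also have "csum id ws (\<lambda>u v. X u * plus_part \<Lambda> v) + \<dots> = csum id ws (\<lambda>u v. X u * \<Lambda> v)"
    unfolding csum_add[symmetric]
    by (rule arg_cong[of _ _ "csum id ws"]) (auto simp: plus_part_def fun_eq_iff)
  finally show ?thesis .
qed

lemma half_right_eq:
  assumes "X [] = 0"
  shows "(\<Gamma> \<succ> X) ws = csum Not ws (\<lambda>u v. \<Gamma> u * X v)"
proof (cases "ws = []")
  case True
  then show ?thesis by (simp add: half_right_def coprod_right_plus_def plus_part_def)
next
  case False
  have X: "plus_part X = X" using assms by (auto simp: plus_part_def)
  have "(\<Gamma> \<succ> X) ws = csum Not ws (\<lambda>u v. plus_part \<Gamma> u * X v) + \<Gamma> [] * X ws"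
    unfolding half_right_def coprod_right_plus_def X
    by (subst sum_mset_minus_zero) (simp_all add: plus_part_def sum_coprod_right)
  also have "\<Gamma> [] * X ws = csum Not ws (\<lambda>u v. if u = [] then \<Gamma> [] * X v else 0)"
    using False by (subst csum_empty_left) auto
  also have "csum Not ws (\<lambda>u v. plus_part \<Gamma> u * X v) + \<dots> = csum Not ws (\<lambda>u v. \<Gamma> u * X v)"
    unfolding csum_add[symmetric]
    by (rule arg_cong[of _ _ "csum Not ws"]) (auto simp: plus_part_def fun_eq_iff)
  finally show ?thesis .
qed

lemma half_left_Nil: "X [] = 0 \<Longrightarrow> (X \<prec> \<Lambda>) [] = 0"
  by (simp add: half_left_eq)

lemma half_right_Nil: "X [] = 0 \<Longrightarrow> (\<Gamma> \<succ> X) [] = 0"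
  by (simp add: half_right_eq)

text \<open>This law and the next two are the dendriform axioms, one for each of the first three
  cases of \<open>csum_coassoc\<close>.\<close>

lemma half_left_half_left:
  assumes "X [] = 0"
  shows "X \<prec> \<Lambda> \<prec> \<Theta> = X \<prec> conv \<Lambda> \<Theta>"
proof
  fix ws
  show "(X \<prec> \<Lambda> \<prec> \<Theta>) ws = (X \<prec> conv \<Lambda> \<Theta>) ws"
    using csum_coassoc[OF coassoc_case.intros(1), of ws "\<lambda>u m v. X u * \<Lambda> m * \<Theta> v"] assms
    by (simp add: half_left_eq half_left_Nil conv_eq csum_mult_left csum_mult_right mult.assoc)
qed

lemma half_right_half_left:
  assumes "X [] = 0"
  shows "\<Gamma> \<succ> X \<prec> \<Lambda> = \<Gamma> \<succ> (X \<prec> \<Lambda>)"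
proof
  fix ws
  show "(\<Gamma> \<succ> X \<prec> \<Lambda>) ws = (\<Gamma> \<succ> (X \<prec> \<Lambda>)) ws"
    using csum_coassoc[OF coassoc_case.intros(2), of ws "\<lambda>u m v. \<Gamma> u * X m * \<Lambda> v"] assms
    by (simp add: half_left_eq half_right_eq half_left_Nil half_right_Nil
        csum_mult_left csum_mult_right mult.assoc)
qed

lemma half_right_half_right:
  assumes "X [] = 0"
  shows "\<Gamma> \<succ> (\<Lambda> \<succ> X) = conv \<Gamma> \<Lambda> \<succ> X"
proof
  fix ws
  show "(\<Gamma> \<succ> (\<Lambda> \<succ> X)) ws = (conv \<Gamma> \<Lambda> \<succ> X) ws"
    using csum_coassoc[OF coassoc_case.intros(3), of ws "\<lambda>u m v. \<Gamma> u * \<Lambda> m * X v"] assms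
    by (simp add: half_right_eq half_right_Nil conv_eq csum_mult_left csum_mult_right mult.assoc)
qed

lemma half_left_counit:
  assumes "X [] = 0"
  shows "X \<prec> counit = X"
proof
  fix ws
  have "csum id ws (\<lambda>u v. X u * counit v) = csum id ws (\<lambda>u v. if v = [] then X u else 0)"
    by (rule arg_cong[of _ _ "csum id ws"]) (auto simp: counit_def fun_eq_iff)
  then show "(X \<prec> counit) ws = X ws"
    using assms by (cases "ws = []") (simp_all add: half_left_eq csum_empty_right)
qed

lemma half_right_counit:
  assumes "X [] = 0"
  shows "counit \<succ> X = X"
proof
  fix ws
  have "csum Not ws (\<lambda>u v. counit u * X v) = csum Not ws (\<lambda>u v. if u = [] then X v else 0)"
    by (rule arg_cong[of _ _ "csum Not ws"]) (auto simp: counit_def fun_eq_iff)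
  then show "(counit \<succ> X) ws = X ws"
    using assms by (cases "ws = []") (simp_all add: half_right_eq csum_empty_left)
qed

text \<open>The relation \<open>(\<Theta> * \<Psi>)(a\<^sub>1\<dots>a\<^sub>n) = 0\<close> solved for the term in which all letters are selected.\<close>

function left_inv :: "('a barword \<Rightarrow> 'k::field) \<Rightarrow> 'a list \<Rightarrow> 'k" where
  "left_inv \<Psi> as = (if as = [] then 1 else
     - (\<Sum>S \<in> {S. S \<subseteq> {..<length as}}. if length (nths as S) < length as
          then left_inv \<Psi> (nths as S) * \<Psi> (gaps as S @ bar (drop (cut S) as)) else 0))"
  by pat_completeness auto
termination
  by (relation "measure (\<lambda>(\<Psi>, as). length as)") auto

declare left_inv.simps [simp del]

lemma left_inv_Nil [simp]: "left_inv \<Psi> [] = 1"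
  by (simp add: left_inv.simps)

lemma left_inv_eq:
  "as \<noteq> [] \<Longrightarrow> left_inv \<Psi> as =
    - dsum full as (\<lambda>u v r. if length u < length as then left_inv \<Psi> u * \<Psi> (v @ bar r) else 0)"
  by (subst left_inv.simps) (simp add: dsum_def)

definition left_inv_char :: "('a barword \<Rightarrow> 'k::field) \<Rightarrow> 'a barword \<Rightarrow> 'k" where
  "left_inv_char \<Psi> ws = (\<Prod>w\<leftarrow>ws. left_inv \<Psi> (letters w))"

lemma left_inv_char_append: "left_inv_char \<Psi> (ws @ ws') = left_inv_char \<Psi> ws * left_inv_char \<Psi> ws'"
  by (simp add: left_inv_char_def)

lemma left_inv_char_bar [simp]: "left_inv_char \<Psi> (bar as) = left_inv \<Psi> as"
  by (cases as) (simp_all add: left_inv_char_def letters_def)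

text \<open>By multiplicativity the convolution factors over the words, and the recursion defining
  \<open>left_inv\<close> makes the factor of the first word vanish.\<close>

lemma conv_left_inv_char:
  assumes "\<Psi> [] = 1" "\<And>w w'. \<Psi> (w @ w') = \<Psi> w * \<Psi> w'"
  shows "conv (left_inv_char \<Psi>) \<Psi> = counit"
proof
  fix ws
  show "conv (left_inv_char \<Psi>) \<Psi> ws = counit ws"
  proof (cases ws)
    case Nil
    then show ?thesis by (simp add: conv_eq counit_def left_inv_char_def assms(1))
  next
    case (Cons w ws')
    let ?as = "letters w"
    have "dsum full ?as (\<lambda>u v r. left_inv \<Psi> u * \<Psi> (v @ bar r)) = 0"
      by (subst dsum_all_left) (simp_all add: left_inv_eq[of ?as] assms(1))
    moreover have "left_inv_char \<Psi> (bar u @ u') * \<Psi> (v @ bar r @ v') =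
        left_inv \<Psi> u * \<Psi> (v @ bar r) * (left_inv_char \<Psi> u' * \<Psi> v')" for u u' v r v'
      by (simp add: left_inv_char_append assms(2))
    then have "conv (left_inv_char \<Psi>) \<Psi> ws =
      dsum full ?as (\<lambda>u v r. left_inv \<Psi> u * \<Psi> (v @ bar r)) * conv (left_inv_char \<Psi>) \<Psi> ws'"
      unfolding Cons conv_eq csum.simps by (simp only: dsum_mult_right csum_mult_left csum_dsum_swap)
    ultimately show ?thesis by (simp add: Cons counit_def)
  qed
qed

section \<open>Linearity of the convolution inverse in each letter\<close>

lemma linear_add:
  "Vector_Spaces.linear s (*) f \<Longrightarrow> Vector_Spaces.linear s (*) g \<Longrightarrow>
    Vector_Spaces.linear s (*) (\<lambda>x. f x + g x)"
  by (simp add: Vector_Spaces.linear_iff algebra_simps)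

lemma linear_mult_left:
  "Vector_Spaces.linear s (*) f \<Longrightarrow> Vector_Spaces.linear s (*) (\<lambda>x. c * f x)" for c :: "'k::field"
  by (simp add: Vector_Spaces.linear_iff algebra_simps)

lemma linear_mult_right:
  "Vector_Spaces.linear s (*) f \<Longrightarrow> Vector_Spaces.linear s (*) (\<lambda>x. f x * c)" for c :: "'k::field"
  by (simp add: Vector_Spaces.linear_iff algebra_simps)

lemma linear_zero:
  fixes s :: "'k::field \<Rightarrow> 'a::ab_group_add \<Rightarrow> 'a"
  shows "vector_space s \<Longrightarrow> Vector_Spaces.linear s (*) (\<lambda>x. 0::'k)"
  by (auto simp: Vector_Spaces.linear_iff vector_space_def algebra_simps)

lemma linear_dsum_pointwise:
  fixes f :: "_ \<Rightarrow> _ \<Rightarrow> _ \<Rightarrow> _ \<Rightarrow> 'k::field"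
  assumes "\<And>u v r. Vector_Spaces.linear s (*) (\<lambda>x. f x u v r)"
  shows "Vector_Spaces.linear s (*) (\<lambda>x. dsum P as (f x))"
  using assms by (simp add: dsum_def Vector_Spaces.linear_iff sum.distrib sum_distrib_left)

text \<open>In every splitting the letter \<open>x\<close> lands in exactly one place: the subword,
  a completed run or the pending run. The three assumptions are linearity in each of these
  places.\<close>

lemma linear_dsum:
  fixes s :: "'k::field \<Rightarrow> 'a::ab_group_add \<Rightarrow> 'a"
  defines "L \<equiv> Vector_Spaces.linear s (*)"
  assumes "\<And>u1 u2 v r. L (\<lambda>x. f (u1 @ x # u2) v r)"
    and "\<And>u v1 x1 x2 v2 r. L (\<lambda>x. f u (v1 @ bar (x1 @ x # x2) @ v2) r)"
    and "\<And>u v r1 r2. L (\<lambda>x. f u v (r1 @ x # r2))"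
  shows "L (\<lambda>x. dsum full (xs @ x # ys) f)"
  using assms(2-)
proof (induction ys arbitrary: f rule: rev_induct)
  case Nil
  have "(\<lambda>x. dsum full (xs @ [x]) f) = (\<lambda>x. dsum full xs (\<lambda>u v r. f (u @ [x]) (v @ bar r) [] + f u v (r @ [x])))"
    by (simp add: dsum_snoc dsum_add)
  moreover have "L (\<lambda>x. f (u @ [x]) (v @ bar r) [] + f u v (r @ [x]))" for u v r
    unfolding L_def by (intro linear_add; fold L_def; rule Nil)
  ultimately show ?case
    unfolding L_def by (simp only:) (rule linear_dsum_pointwise)
next
  case (snoc b ys)
  have 1: "L (\<lambda>x. dsum full (xs @ x # ys) (\<lambda>u v r. f (u @ [b]) (v @ bar r) []))"
  proof (rule snoc.IH)
    show "L (\<lambda>x. f ((u1 @ x # u2) @ [b]) (v @ bar r) [])" for u1 u2 v r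
      using snoc.prems(1)[of u1 "u2 @ [b]"] by simp
    show "L (\<lambda>x. f (u @ [b]) ((v1 @ bar (x1 @ x # x2) @ v2) @ bar r) [])" for u v1 x1 x2 v2 r
      using snoc.prems(2)[of "u @ [b]" v1 x1 x2 "v2 @ bar r" "[]"] by simp
    show "L (\<lambda>x. f (u @ [b]) (v @ bar (r1 @ x # r2)) [])" for u v r1 r2
      using snoc.prems(2)[of "u @ [b]" v r1 r2 "[]" "[]"] by simp
  qed
  have 2: "L (\<lambda>x. dsum full (xs @ x # ys) (\<lambda>u v r. f u v (r @ [b])))"
  proof (rule snoc.IH)
    show "L (\<lambda>x. f u v ((r1 @ x # r2) @ [b]))" for u v r1 r2
      using snoc.prems(3)[of u v r1 "r2 @ [b]"] by simp
  qed (rule snoc.prems)+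
  have "dsum full (xs @ x # ys @ [b]) f = dsum full (xs @ x # ys) (\<lambda>u v r. f (u @ [b]) (v @ bar r) []) +
      dsum full (xs @ x # ys) (\<lambda>u v r. f u v (r @ [b]))" for x
    using dsum_snoc[of "xs @ x # ys" full b f] by simp
  then show ?case
    using linear_add[OF 1[unfolded L_def] 2[unfolded L_def]] by (simp add: L_def)
qed

text \<open>This places the inverse in the carrier of \<open>character_group\<close>, where the
  group inverse is sought.\<close>

lemma linear_left_inv:
  fixes scale :: "'k::field \<Rightarrow> 'a::ring_1 \<Rightarrow> 'a"
  assumes "vector_space scale" "\<Psi> \<in> Lin_H scale"
  shows "Vector_Spaces.linear scale (*) (\<lambda>x. left_inv \<Psi> (xs @ x # ys))"
proof (induction "length xs + length ys" arbitrary: xs ys rule: less_induct)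
  case less
  let ?L = "Vector_Spaces.linear scale (*) :: ('a \<Rightarrow> 'k) \<Rightarrow> bool"
  \<comment> \<open>The length of \<open>xs @ x # ys\<close>, written so that the guard in
    \<open>?f\<close> visibly does not depend on \<open>x\<close>.\<close>
  let ?n = "Suc (length xs + length ys)"
  let ?f = "\<lambda>u v r. if length u < ?n then left_inv \<Psi> u * \<Psi> (v @ bar r) else 0"
  have \<Psi>: "?L (\<lambda>x. \<Psi> (us @ bar (xs @ x # ys) @ vs))" for us xs ys vs
    using assms(2) by (simp add: Lin_H_def)
  have "?L (\<lambda>x. dsum full (xs @ x # ys) ?f)"
  proof (rule linear_dsum)
    show "?L (\<lambda>x. ?f (u1 @ x # u2) v r)" for u1 u2 v r
      using less[of u1 u2] linear_zero[OF assms(1)]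
      by (cases "length u1 + length u2 < length xs + length ys") (auto intro: linear_mult_right)
    show "?L (\<lambda>x. ?f u (v1 @ bar (x1 @ x # x2) @ v2) r)" for u v1 x1 x2 v2 r
      using linear_mult_left[OF \<Psi>[of v1 x1 x2 "v2 @ bar r"], of "left_inv \<Psi> u"] linear_zero[OF assms(1)]
      by (cases "length u < ?n") simp_all
    show "?L (\<lambda>x. ?f u v (r1 @ x # r2))" for u v r1 r2
      using linear_mult_left[OF \<Psi>[of v r1 r2 "[]"], of "left_inv \<Psi> u"] linear_zero[OF assms(1)]
      by (cases "length u < ?n") simp_all
  qed
  then have "?L (\<lambda>x. - 1 * dsum full (xs @ x # ys) ?f)"
    by (rule linear_mult_left)
  then show ?case by (simp add: left_inv_eq)
qed

lemma left_inv_char_characters: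
  assumes "vector_space scale" "\<Psi> \<in> Lin_H scale"
  shows "left_inv_char \<Psi> \<in> characters scale"
proof -
  have "Vector_Spaces.linear scale (*) (\<lambda>x. left_inv_char \<Psi> (us @ bar (xs @ x # ys) @ vs))"
    for us xs ys vs
    unfolding left_inv_char_append left_inv_char_bar
    by (intro linear_mult_left linear_mult_right linear_left_inv assms)
  then have "left_inv_char \<Psi> \<in> Lin_H scale" unfolding Lin_H_def by blast
  moreover have "left_inv_char \<Psi> [] = 1" by (simp add: left_inv_char_def)
  ultimately show ?thesis
    unfolding characters_def using left_inv_char_append by blast
qed

lemma character_inverse:
  assumes "vector_space scale" "\<Psi> \<in> characters scale"
  shows "conv \<Psi> (inv\<^bsub>character_group scale\<^esub> \<Psi>) = counit"
    and "conv (inv\<^bsub>character_group scale\<^esub> \<Psi>) \<Psi> = counit"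
proof -
  let ?Z = "left_inv_char \<Psi>"
  have \<Psi>: "\<Psi> \<in> Lin_H scale" "\<Psi> [] = 1" "\<And>w w'. \<Psi> (w @ w') = \<Psi> w * \<Psi> w'"
    using assms(2) by (auto simp: characters_def)
  have Z: "?Z \<in> characters scale" using left_inv_char_characters assms(1) \<Psi>(1) .
  have l: "conv ?Z \<Psi> = counit" using conv_left_inv_char \<Psi>(2,3) .
  have r: "conv \<Psi> ?Z = counit"
  proof -
    \<comment> \<open>The construction is applied twice: the left inverse \<open>?Y\<close> of
      \<open>?Z\<close> equals \<open>\<Psi>\<close> by associativity, so \<open>?Z\<close> is a
      right inverse of \<open>\<Psi>\<close> too.\<close>
    let ?Y = "left_inv_char ?Z"
    have YZ: "conv ?Y ?Z = counit"
      by (rule conv_left_inv_char) (use Z in \<open>auto simp: characters_def\<close>)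
    have "?Y = conv ?Y (conv ?Z \<Psi>)" by (simp add: l)
    also have "\<dots> = \<Psi>" by (simp only: conv_assoc[symmetric] YZ conv_counit_left)
    finally show ?thesis using YZ by simp
  qed
  \<comment> \<open>The group inverse is a definite description, so \<open>?Z\<close> is identified
    with it by uniqueness of inverses.\<close>
  have "(THE y. y \<in> characters scale \<and> conv \<Psi> y = counit \<and> conv y \<Psi> = counit) = ?Z"
  proof (rule the_equality)
    show "?Z \<in> characters scale \<and> conv \<Psi> ?Z = counit \<and> conv ?Z \<Psi> = counit"
      using Z l r by blast
    fix y assume y: "y \<in> characters scale \<and> conv \<Psi> y = counit \<and> conv y \<Psi> = counit"
    have "y = conv (conv ?Z \<Psi>) y" by (simp add: l)
    also have "\<dots> = ?Z" using y by (simp add: conv_assoc)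
    finally show "y = ?Z" .
  qed
  then have "inv\<^bsub>character_group scale\<^esub> \<Psi> = ?Z"
    by (simp add: m_inv_def character_group_def)
  then show "conv \<Psi> (inv\<^bsub>character_group scale\<^esub> \<Psi>) = counit"
    and "conv (inv\<^bsub>character_group scale\<^esub> \<Psi>) \<Psi> = counit"
    using l r by simp_all
qed

section \<open>Boolean cumulants on words\<close>

lemma half_left_bar:
  assumes "X [] = 0" "xs \<noteq> []"
  shows "(X \<prec> \<Lambda>) (bar xs) = dsum id xs (\<lambda>u v r. X (bar u) * \<Lambda> (v @ bar r))"
  using assms by (simp add: half_left_eq csum_bar)

text \<open>An infinitesimal character kills products of non-empty bar words, so the unselected
  letters form a single run. That run contains the first letter and is therefore a prefix.\<close>

lemma dsum_right_infinitesimal: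
  fixes \<beta> :: "'a barword \<Rightarrow> 'k::field"
  assumes "\<beta> [] = 0" "\<And>w w'. w \<noteq> [] \<Longrightarrow> w' \<noteq> [] \<Longrightarrow> \<beta> (w @ w') = 0" "xs \<noteq> []"
  shows "dsum Not xs (\<lambda>u v r. g u * \<beta> (v @ bar r)) =
    (\<Sum>k=1..length xs. \<beta> (bar (take k xs)) * g (drop k xs))"
  using assms(3)
proof (induction xs arbitrary: g rule: rev_nonempty_induct)
  case (single x)
  then show ?case by (simp add: dsum_single assms(1) mult.commute)
next
  case (snoc b xs)
  \<comment> \<open>If \<open>b\<close> is unselected, the pending run is non-empty and any
    completed run gives 0. What survives is the empty selection, the summand for the full
    length.\<close>
  have "dsum Not xs (\<lambda>u v r. g u * \<beta> (v @ bar (r @ [b]))) =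
    dsum Not xs (\<lambda>u v r. if v = [] then g u * \<beta> (v @ bar (r @ [b])) else 0)"
    by (rule arg_cong[of _ _ "dsum Not xs"]) (auto simp: fun_eq_iff assms(2))
  also have "\<dots> = g [] * \<beta> (bar (xs @ [b]))"
    using snoc.hyps by (subst dsum_right_no_gap) auto
  finally show ?case
    using snoc.hyps snoc.IH[of "\<lambda>u. g (u @ [b])"] by (simp add: dsum_snoc mult.commute)
qed

lemma half_right_bar:
  assumes "\<beta> \<in> inf_characters scale" "xs \<noteq> []"
  shows "(\<Gamma> \<succ> \<beta>) (bar xs) = (\<Sum>k=1..length xs. \<beta> (bar (take k xs)) * \<Gamma> (bar (drop k xs)))"
proof -
  have \<beta>: "\<beta> [] = 0" "\<And>w w'. w \<noteq> [] \<Longrightarrow> w' \<noteq> [] \<Longrightarrow> \<beta> (w @ w') = 0"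
    using assms(1) by (auto simp: inf_characters_def)
  show ?thesis
    using assms(2) \<beta>(1) dsum_right_infinitesimal[of \<beta> xs "\<lambda>u. \<Gamma> (bar u)", OF \<beta> assms(2)]
    by (simp add: half_right_eq csum_bar)
qed

text \<open>The index \<open>k\<close> is the value of \<open>cut S\<close>, one more than the last
  selected position; the condition \<open>r = []\<close> forces the last letter of the prefix to be
  selected.\<close>

lemma dsum_left_last:
  fixes H :: "'a list \<Rightarrow> 'k::comm_ring_1"
  assumes "xs \<noteq> []"
  shows "dsum id xs (\<lambda>u v r. G u v * H r) =
    (\<Sum>k=1..length xs. dsum id (take k xs) (\<lambda>u v r. if r = [] then G u v else 0) * H (drop k xs))"
  using assms
proof (induction xs arbitrary: H rule: rev_nonempty_induct)
  case (single x)
  then show ?case by (simp add: dsum_single)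
next
  case (snoc b xs)
  have "dsum id (xs @ [b]) (\<lambda>u v r. if r = [] then G u v else 0) =
      dsum id xs (\<lambda>u v r. G (u @ [b]) (v @ bar r))"
    using snoc.hyps by (simp add: dsum_snoc)
  then show ?case
    using snoc.hyps snoc.IH[of "\<lambda>r. H (r @ [b])"]
    by (simp add: dsum_snoc dsum_mult_right add.commute)
qed

text \<open>A triangular system: the summand at full length is the unknown itself, since
  \<open>h [] = 1\<close>, and the others involve proper prefixes.\<close>

lemma prefix_convolution_cancel:
  fixes b b' :: "'a list \<Rightarrow> 'k::comm_ring_1"
  assumes "\<And>xs. xs \<noteq> [] \<Longrightarrow>
      (\<Sum>k=1..length xs. b (take k xs) * h (drop k xs)) = (\<Sum>k=1..length xs. b' (take k xs) * h (drop k xs))"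
    and "h [] = 1" "xs \<noteq> []"
  shows "b xs = b' xs"
  using assms(3)
proof (induction "length xs" arbitrary: xs rule: less_induct)
  case less
  have "(\<Sum>k\<in>{1..<length xs}. b (take k xs) * h (drop k xs)) =
      (\<Sum>k\<in>{1..<length xs}. b' (take k xs) * h (drop k xs))"
    by (rule sum.cong[OF refl]) (use less in auto)
  moreover have "{1..length xs} = insert (length xs) {1..<length xs}"
    using less.prems by (auto simp: Suc_le_eq)
  ultimately show ?case
    using assms(1)[OF less.prems] by (simp add: assms(2))
qed

lemma right_power_Suc_bar:
  assumes "\<beta> \<in> inf_characters scale" "xs \<noteq> []"
  shows "right_power \<beta> (Suc n) (bar xs) =
    (\<Sum>k=1..length xs. \<beta> (bar (take k xs)) * right_power \<beta> n (bar (drop k xs)))"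
  using half_right_bar[OF assms] by simp

text \<open>Each factor of the power consumes at least one letter.\<close>

lemma right_power_bar_eq_0:
  assumes "\<beta> \<in> inf_characters scale" "length xs < n"
  shows "right_power \<beta> n (bar xs) = 0"
  using assms(2)
proof (induction n arbitrary: xs)
  case (Suc n)
  show ?case
  proof (cases "xs = []")
    case True
    have "\<beta> [] = 0" using assms(1) by (simp add: inf_characters_def)
    then show ?thesis using True by (simp add: half_right_Nil)
  next
    case False
    have "right_power \<beta> n (bar (drop k xs)) = 0" if "k \<in> {1..length xs}" for k
      by (rule Suc.IH) (use that Suc.prems in auto)
    then show ?thesis
      unfolding right_power_Suc_bar[OF assms(1) False] by (intro sum.neutral) auto
  qed
qed simp

text \<open>A common bound \<open>N\<close> lets a word and all its suffixes be summed over the same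
  range, so that the sums can be interchanged next.\<close>

lemma exp_right_bar_sum:
  assumes "\<beta> \<in> inf_characters scale" "length xs \<le> N"
  shows "exp_right \<beta> (bar xs) = (\<Sum>n\<le>N. right_power \<beta> n (bar xs))"
proof -
  have "(\<Sum>n\<in>{n. 0 < n \<and> right_power \<beta> n (bar xs) \<noteq> 0}. right_power \<beta> n (bar xs)) =
      (\<Sum>n\<in>{1..N}. right_power \<beta> n (bar xs))"
  proof (rule sum.mono_neutral_left)
    have "n \<le> N" if "right_power \<beta> n (bar xs) \<noteq> 0" for n
      using right_power_bar_eq_0[OF assms(1), of xs n] that assms(2) by force
    then show "{n. 0 < n \<and> right_power \<beta> n (bar xs) \<noteq> 0} \<subseteq> {1..N}" by auto
  qed auto
  moreover have "{..N} = insert 0 {1..N}" by auto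
  ultimately show ?thesis by (simp add: exp_right_def)
qed

text \<open>The fixed-point equation \<open>Y = e + Y \<succ> \<beta>\<close> on non-empty words,
  where the counit, the power with exponent 0, vanishes.\<close>

lemma exp_right_bar:
  assumes "\<beta> \<in> inf_characters scale" "xs \<noteq> []"
  shows "exp_right \<beta> (bar xs) =
    (\<Sum>k=1..length xs. \<beta> (bar (take k xs)) * exp_right \<beta> (bar (drop k xs)))"
proof -
  let ?N = "length xs"
  have "exp_right \<beta> (bar xs) = (\<Sum>n\<le>Suc ?N. right_power \<beta> n (bar xs))"
    by (rule exp_right_bar_sum[OF assms(1)]) simp
  also have "\<dots> = (\<Sum>n\<le>?N. right_power \<beta> (Suc n) (bar xs))"
    using assms(2) by (subst sum.atMost_Suc_shift) (simp add: counit_def)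
  also have "\<dots> = (\<Sum>k=1..?N. \<beta> (bar (take k xs)) * (\<Sum>n\<le>?N. right_power \<beta> n (bar (drop k xs))))"
    unfolding right_power_Suc_bar[OF assms] by (subst sum.swap) (simp add: sum_distrib_left)
  also have "\<dots> = (\<Sum>k=1..?N. \<beta> (bar (take k xs)) * exp_right \<beta> (bar (drop k xs)))"
    by (simp add: exp_right_bar_sum[OF assms(1), of _ ?N])
  finally show ?thesis .
qed

text \<open>Triangular again: selecting all letters contributes \<open>C xs\<close>, and every other
  term contains \<open>C\<close> at a shorter word, non-empty because the first letter is
  selected.\<close>

lemma dsum_left_unique:
  fixes C D :: "'a list \<Rightarrow> 'k::comm_ring_1"
  assumes "\<And>xs. xs \<noteq> [] \<Longrightarrow> dsum id xs (\<lambda>u v r. C u * (\<Psi> v * h r)) = dsum id xs (\<lambda>u v r. D u * (\<Psi> v * h r))"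
    and "\<Psi> [] = 1" "h [] = 1" "xs \<noteq> []"
  shows "C xs = D xs"
  using assms(4)
proof (induction "length xs" arbitrary: xs rule: less_induct)
  case less
  have "dsum id xs (\<lambda>u v r. if length u < length xs then C u * (\<Psi> v * h r) else 0) =
      dsum id xs (\<lambda>u v r. if length u < length xs then D u * (\<Psi> v * h r) else 0)"
    by (rule dsum_left_cong) (use less.hyps in auto)
  then show ?case
    using assms(1)[OF less.prems] less.prems dsum_all_left[of id xs "\<lambda>u v r. C u * (\<Psi> v * h r)"]
      dsum_all_left[of id xs "\<lambda>u v r. D u * (\<Psi> v * h r)"] by (simp add: assms(2,3))
qed

lemma exp_right_eq_dsum:
  assumes "\<beta> \<in> inf_characters scale" "R [] = 0"
    and "\<Psi> [] = 1" "\<And>w w'. \<Psi> (w @ w') = \<Psi> w * \<Psi> w'"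
    and eq: "\<Psi> \<succ> \<beta> = R \<prec> \<Psi>" and "xs \<noteq> []"
  shows "exp_right \<beta> (bar xs) =
    dsum id xs (\<lambda>u v r. R (bar u) * (\<Psi> v * exp_right \<beta> (bar r)))"
proof -
  \<comment> \<open>The sum over all selections containing both the first and the last
    position.\<close>
  let ?B = "\<lambda>ys. dsum id ys (\<lambda>u v r. if r = [] then R (bar u) * \<Psi> v else 0)"
  have B: "\<beta> (bar ys) = ?B ys" if "ys \<noteq> []" for ys
  proof (rule prefix_convolution_cancel[where b = "\<lambda>ys. \<beta> (bar ys)" and b' = ?B and h = "\<lambda>r. \<Psi> (bar r)"])
    fix zs :: "'a list" assume zs: "zs \<noteq> []"
    have "(\<Sum>k=1..length zs. \<beta> (bar (take k zs)) * \<Psi> (bar (drop k zs))) =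
        dsum id zs (\<lambda>u v r. (R (bar u) * \<Psi> v) * \<Psi> (bar r))"
      using half_right_bar[OF assms(1) zs, of \<Psi>] half_left_bar[of R zs \<Psi>, OF assms(2) zs]
      by (simp add: eq assms(4) mult.assoc)
    then show "(\<Sum>k=1..length zs. \<beta> (bar (take k zs)) * \<Psi> (bar (drop k zs))) =
        (\<Sum>k=1..length zs. ?B (take k zs) * \<Psi> (bar (drop k zs)))"
      by (simp only: dsum_left_last[OF zs])
  qed (simp_all add: assms(3) that)
  have "exp_right \<beta> (bar xs) = (\<Sum>k=1..length xs. ?B (take k xs) * exp_right \<beta> (bar (drop k xs)))"
    unfolding exp_right_bar[OF assms(1,6)] by (rule sum.cong[OF refl]) (use \<open>xs \<noteq> []\<close> in \<open>simp add: B\<close>)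
  \<comment> \<open>The resummation by the last selected letter is now read backwards, with the
    exponential instead of \<open>\<Psi>\<close> on the tail.\<close>
  also have "\<dots> = dsum id xs (\<lambda>u v r. (R (bar u) * \<Psi> v) * exp_right \<beta> (bar r))"
    using dsum_left_last[OF assms(6)] by (rule sym)
  finally show ?thesis by (simp only: mult.assoc)
qed

section \<open>Non-crossing partitions with a distinguished outer block\<close>

definition NC_on :: "nat set \<Rightarrow> nat set set set" where
  "NC_on X = {\<pi>. partition_on X \<pi> \<and> noncrossing \<pi>}"

text \<open>The flag lets a weight distinguish inner from outer blocks, and replacing it by a
  disjunction declares the blocks of a nested partition inner.\<close>

definition nc_sum :: "(bool \<Rightarrow> nat set \<Rightarrow> 'k::comm_semiring_1) \<Rightarrow> nat set \<Rightarrow> 'k" where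
  "nc_sum w X = (\<Sum>\<pi>\<in>NC_on X. \<Prod>V\<in>\<pi>. w (inner_block \<pi> V) V)"

lemma finite_NC_on: "finite X \<Longrightarrow> finite (NC_on X)"
  by (rule finite_subset[of _ "Pow (Pow X)"]) (auto simp: NC_on_def partition_on_def)

lemma NC_on_finite: "finite X \<Longrightarrow> \<pi> \<in> NC_on X \<Longrightarrow> finite \<pi>"
  by (rule finite_subset[of _ "Pow X"]) (auto simp: NC_on_def partition_on_def)

lemma noncrossingD:
  "noncrossing \<pi> \<Longrightarrow> V \<in> \<pi> \<Longrightarrow> W \<in> \<pi> \<Longrightarrow> a \<in> V \<Longrightarrow> c \<in> V \<Longrightarrow> b \<in> W \<Longrightarrow> d \<in> W \<Longrightarrow>
    a < b \<Longrightarrow> b < c \<Longrightarrow> c < d \<Longrightarrow> V = W"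
  unfolding noncrossing_def by blast

lemma NC_onD:
  assumes "\<pi> \<in> NC_on X"
  shows "\<Union>\<pi> = X" "{} \<notin> \<pi>" "noncrossing \<pi>"
    and "\<And>V W x. V \<in> \<pi> \<Longrightarrow> W \<in> \<pi> \<Longrightarrow> x \<in> V \<Longrightarrow> x \<in> W \<Longrightarrow> V = W"
  using assms unfolding NC_on_def partition_on_def disjoint_def by blast+

lemma NC_onI:
  assumes "\<Union>\<pi> = X" "{} \<notin> \<pi>" "noncrossing \<pi>"
    and "\<And>V W x. V \<in> \<pi> \<Longrightarrow> W \<in> \<pi> \<Longrightarrow> x \<in> V \<Longrightarrow> x \<in> W \<Longrightarrow> V = W"
  shows "\<pi> \<in> NC_on X"
  using assms unfolding NC_on_def partition_on_def disjoint_def by blast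

section \<open>Translation of non-crossing partitions\<close>

lemma noncrossing_shift: "noncrossing ((`) ((+) m) ` \<pi>) \<longleftrightarrow> noncrossing \<pi>"
proof -
  have inj: "(+) m ` V = (+) m ` W \<longleftrightarrow> V = W" for V W :: "nat set"
    by (rule inj_image_eq_iff) simp
  show ?thesis
  proof
    assume L: "noncrossing ((`) ((+) m) ` \<pi>)"
    show "noncrossing \<pi>"
      unfolding noncrossing_def
    proof (intro ballI allI impI)
      fix V W a b c d
      assume "V \<in> \<pi>" "W \<in> \<pi>" "a < b \<and> b < c \<and> c < d \<and> a \<in> V \<and> c \<in> V \<and> b \<in> W \<and> d \<in> W"
      then have "(+) m ` V = (+) m ` W"
        using L by (intro noncrossingD[OF L, of _ _ "m + a" "m + c" "m + b" "m + d"]) auto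
      then show "V = W" by (simp only: inj)
    qed
  next
    assume R: "noncrossing \<pi>"
    show "noncrossing ((`) ((+) m) ` \<pi>)"
      unfolding noncrossing_def
    proof (intro ballI allI impI)
      fix V' W' a b c d
      assume "V' \<in> (`) ((+) m) ` \<pi>" "W' \<in> (`) ((+) m) ` \<pi>"
        and *: "a < b \<and> b < c \<and> c < d \<and> a \<in> V' \<and> c \<in> V' \<and> b \<in> W' \<and> d \<in> W'"
      then obtain V W where VW: "V \<in> \<pi>" "W \<in> \<pi>" "V' = (+) m ` V" "W' = (+) m ` W" by blast
      with * obtain a' b' c' d' where
        "a' \<in> V" "c' \<in> V" "b' \<in> W" "d' \<in> W" "a = m + a'" "b = m + b'" "c = m + c'" "d = m + d'"
        by blast
      then have "V = W" using * VW by (intro noncrossingD[OF R, of V W a' c' b' d']) auto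
      then show "V' = W'" using VW by simp
    qed
  qed
qed

lemma inner_block_shift: "inner_block ((`) ((+) m) ` \<pi>) ((+) m ` V) \<longleftrightarrow> inner_block \<pi> V"
  by (simp add: inner_block_def)

lemma NC_on_shift: "NC_on ((+) m ` X) = (`) ((`) ((+) m)) ` NC_on X"
proof (intro equalityI subsetI)
  fix \<rho> assume "\<rho> \<in> (`) ((`) ((+) m)) ` NC_on X"
  then obtain \<pi> where \<pi>: "\<pi> \<in> NC_on X" "\<rho> = (`) ((+) m) ` \<pi>" by blast
  show "\<rho> \<in> NC_on ((+) m ` X)"
  proof (rule NC_onI)
    show "\<Union>\<rho> = (+) m ` X" using NC_onD(1)[OF \<pi>(1)] \<pi>(2) by auto
    show "{} \<notin> \<rho>" using NC_onD(2)[OF \<pi>(1)] \<pi>(2) by auto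
    show "noncrossing \<rho>" using NC_onD(3)[OF \<pi>(1)] \<pi>(2) by (simp add: noncrossing_shift)
    show "V = W" if "V \<in> \<rho>" "W \<in> \<rho>" "x \<in> V" "x \<in> W" for V W x
    proof -
      obtain V' W' where VW: "V' \<in> \<pi>" "W' \<in> \<pi>" "V = (+) m ` V'" "W = (+) m ` W'"
        using \<pi>(2) \<open>V \<in> \<rho>\<close> \<open>W \<in> \<rho>\<close> by blast
      then obtain x' where "x' \<in> V'" "x' \<in> W'"
        using \<open>x \<in> V\<close> \<open>x \<in> W\<close> by auto
      then have "V' = W'" by (rule NC_onD(4)[OF \<pi>(1) VW(1,2)])
      then show ?thesis by (simp only: VW(3,4))
    qed
  qed
next
  fix \<rho> assume \<rho>: "\<rho> \<in> NC_on ((+) m ` X)"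
  define \<pi> where "\<pi> = (\<lambda>V. (+) m -` V) ` \<rho>"
  have unshift: "(+) m ` ((+) m -` V) = V" if "V \<in> \<rho>" for V
  proof -
    have "V \<subseteq> range ((+) m)" using NC_onD(1)[OF \<rho>] that by blast
    then show ?thesis by (simp only: image_vimage_eq Int_absorb2)
  qed
  have "(`) ((+) m) ` \<pi> = (\<lambda>V. V) ` \<rho>"
    unfolding \<pi>_def image_image by (rule image_cong) (simp_all only: unshift)
  then have eq: "\<rho> = (`) ((+) m) ` \<pi>" by (simp only: image_ident)
  have "\<pi> \<in> NC_on X"
  proof (rule NC_onI)
    show "\<Union>\<pi> = X"
    proof -
      have "\<Union>\<pi> = (+) m -` \<Union>\<rho>" by (auto simp: \<pi>_def)
      also have "\<dots> = X" unfolding NC_onD(1)[OF \<rho>] by (rule inj_vimage_image_eq) simp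
      finally show ?thesis .
    qed
    show "{} \<notin> \<pi>"
    proof
      assume "{} \<in> \<pi>"
      then obtain V where "V \<in> \<rho>" "(+) m -` V = {}" by (auto simp: \<pi>_def)
      then show False using unshift[of V] NC_onD(2)[OF \<rho>] by auto
    qed
    show "noncrossing \<pi>" using NC_onD(3)[OF \<rho>] eq by (simp add: noncrossing_shift)
    show "V = W" if "V \<in> \<pi>" "W \<in> \<pi>" "x \<in> V" "x \<in> W" for V W x
      using that NC_onD(4)[OF \<rho>, of _ _ "m + x"] by (auto simp: \<pi>_def)
  qed
  then show "\<rho> \<in> (`) ((`) ((+) m)) ` NC_on X" using eq by blast
qed

lemma nc_sum_shift: "nc_sum w ((+) m ` X) = nc_sum (\<lambda>b V. w b ((+) m ` V)) X"
proof -
  have inj: "inj_on ((`) ((+) m)) A" for A :: "nat set set"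
    by (rule inj_onI) (simp add: inj_image_eq_iff)
  have inj2: "inj_on ((`) ((`) ((+) m))) A" for A :: "nat set set set"
    by (rule inj_onI) (metis inj inj_image_eq_iff)
  show ?thesis
    unfolding nc_sum_def NC_on_shift
    by (simp add: sum.reindex[OF inj2] prod.reindex[OF inj] inner_block_shift)
qed

lemma conn_component_convex:
  assumes "J \<in> conn_component X ` X" "a \<in> J" "b \<in> J" "a \<le> x" "x \<le> b"
  shows "x \<in> J"
proof -
  obtain i where i: "J = conn_component X i" using assms(1) by blast
  have "J = conn_component X a" using conn_component_eq[of a X i] assms(2) i by simp
  moreover from this have "b \<in> conn_component X a" using assms(3) by simp
  then have "{min a b..max a b} \<subseteq> X" by (simp add: conn_component_def)
  then have "x \<in> conn_component X a" using assms(4,5) by (auto simp: conn_component_def)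
  ultimately show ?thesis by simp
qed

lemma conn_components_disjoint:
  assumes "J \<in> conn_component X ` X" "J' \<in> conn_component X ` X" "x \<in> J" "x \<in> J'"
  shows "J = J'"
  using assms conn_component_eq by blast

lemma conn_component_gap:
  assumes "x \<in> X" "y \<in> X" "y \<notin> conn_component X x"
  obtains s where "s \<notin> X" "min x y < s" "s < max x y"
proof -
  from assms(3) obtain s where s: "s \<in> {min x y..max x y}" "s \<notin> X"
    unfolding conn_component_def by blast
  then have "s \<noteq> x" "s \<noteq> y" using assms by auto
  with s have "min x y < s" "s < max x y" by (auto simp: min_def max_def split: if_splits)
  with s(2) show ?thesis by (rule that)
qed

section \<open>Partitions with prescribed block through position 0, factored over the components of
  its complement\<close>

locale outer_block =
  fixes n :: nat and S :: "nat set"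
  assumes S: "S \<subseteq> {..<n}" "0 \<in> S"
begin

definition "X = {..<n} - S"

definition "I = conn_component X ` X"

text \<open>Since \<open>0\<close> belongs to \<open>S\<close>, such a component is enclosed by
  \<open>S\<close>, and all blocks inside it are inner.\<close>

definition "below J \<longleftrightarrow> (\<exists>s\<in>S. \<forall>j\<in>J. j < s)"

definition "partitions = {\<pi> \<in> NC_on {..<n}. S \<in> \<pi>}"

definition "glue g = insert S (\<Union>J\<in>I. g J)"

text \<open>The inverse of \<open>glue\<close>; \<open>restrict\<close> makes the family
  extensional, as \<open>PiE\<close> demands.\<close>

definition "parts \<pi> = restrict (\<lambda>J. {V \<in> \<pi>. V \<subseteq> J}) I"

lemma glue_cases: "V \<in> glue g \<Longrightarrow> V = S \<or> (\<exists>J\<in>I. V \<in> g J)"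
  by (auto simp: glue_def)

lemma I_subset: "J \<in> I \<Longrightarrow> J \<subseteq> X"
  using conn_component_subset by (auto simp: I_def)

lemma I_cover: "x \<in> X \<Longrightarrow> \<exists>J\<in>I. x \<in> J"
  using conn_component_self by (auto simp: I_def)

lemmas convex = conn_component_convex[of _ X, folded I_def]
lemmas disjoint = conn_components_disjoint[of _ X, folded I_def]

text \<open>Two points of \<open>V\<close> in different components are separated by some
  \<open>s\<close> in \<open>S\<close>; then \<open>0\<close> and \<open>s\<close> in
  \<open>S\<close> cross the two points of \<open>V\<close>.\<close>

lemma block_subset:
  assumes "\<pi> \<in> partitions" "V \<in> \<pi>" "V \<noteq> S" "J \<in> I" "x \<in> V" "x \<in> J"
  shows "V \<subseteq> J"
proof
  fix y assume y: "y \<in> V"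
  have \<pi>: "\<pi> \<in> NC_on {..<n}" "S \<in> \<pi>" using assms(1) by (auto simp: partitions_def)
  have VS: "V \<inter> S = {}" using NC_onD(4)[OF \<pi>(1) assms(2) \<pi>(2)] assms(3) by blast
  have VX: "V \<subseteq> X" using VS NC_onD(1)[OF \<pi>(1)] assms(2) by (auto simp: X_def)
  have J: "J = conn_component X x" using assms(4,6) conn_component_eq by (auto simp: I_def)
  show "y \<in> J"
  proof (rule ccontr)
    assume "y \<notin> J"
    then obtain s where s: "s \<notin> X" "min x y < s" "s < max x y"
      using conn_component_gap[of x X y] VX y assms(5) J by blast
    have mm: "min x y \<in> V" "max x y \<in> V" using y assms(5) by (auto simp: min_def max_def)
    then have "max x y < n" "min x y \<noteq> 0" using VX VS S(2) by (auto simp: X_def)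
    then have "s \<in> S" "0 < min x y" using s by (auto simp: X_def)
    then have "S = V"
      using noncrossingD[OF NC_onD(3)[OF \<pi>(1)] \<pi>(2) assms(2) S(2) _ mm] s by blast
    then show False using assms(3) by simp
  qed
qed

lemma parts_mem:
  assumes "\<pi> \<in> partitions"
  shows "parts \<pi> \<in> PiE I NC_on"
proof (rule PiE_I)
  have \<pi>: "\<pi> \<in> NC_on {..<n}" "S \<in> \<pi>" using assms by (auto simp: partitions_def)
  fix J assume J: "J \<in> I"
  have "{V \<in> \<pi>. V \<subseteq> J} \<in> NC_on J"
  proof (rule NC_onI)
    show "\<Union>{V \<in> \<pi>. V \<subseteq> J} = J"
    proof (intro equalityI subsetI)
      fix x assume x: "x \<in> J"
      then have "x \<in> X" using I_subset[OF J] by blast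
      then have xn: "x \<in> {..<n}" "x \<notin> S" by (auto simp: X_def)
      then obtain V where V: "V \<in> \<pi>" "x \<in> V" using NC_onD(1)[OF \<pi>(1)] by blast
      then have "V \<subseteq> J" using block_subset[OF assms V(1) _ J V(2) x] xn by blast
      then show "x \<in> \<Union>{V \<in> \<pi>. V \<subseteq> J}" using V by blast
    qed blast
    show "{} \<notin> {V \<in> \<pi>. V \<subseteq> J}" using NC_onD(2)[OF \<pi>(1)] by blast
    show "noncrossing {V \<in> \<pi>. V \<subseteq> J}"
      using NC_onD(3)[OF \<pi>(1)] by (simp add: noncrossing_def)
    show "V = W" if "V \<in> {V \<in> \<pi>. V \<subseteq> J}" "W \<in> {V \<in> \<pi>. V \<subseteq> J}" "x \<in> V" "x \<in> W" for V W x
      using that NC_onD(4)[OF \<pi>(1)] by blast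
  qed
  then show "parts \<pi> J \<in> NC_on J" using J by (simp add: parts_def)
qed (simp add: parts_def)

context
  fixes g assumes g: "g \<in> PiE I NC_on"
begin

lemma gD: "J \<in> I \<Longrightarrow> g J \<in> NC_on J"
  using g by (auto simp: PiE_def)

lemma g_subset: "J \<in> I \<Longrightarrow> V \<in> g J \<Longrightarrow> V \<subseteq> J"
  using NC_onD(1)[OF gD] by blast

lemma S_notin: "J \<in> I \<Longrightarrow> S \<notin> g J"
  using g_subset I_subset S(2) by (fastforce simp: X_def)

text \<open>Components are convex and disjoint. A crossing would put a point of \<open>S\<close>
  into a component or else take place within a single one, where \<open>g J\<close> is
  non-crossing.\<close>

lemma glue_mem: "glue g \<in> partitions"
proof -
  have "glue g \<in> NC_on {..<n}"
  proof (rule NC_onI)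
    have "(\<Union>J\<in>I. \<Union>(g J)) = X"
    proof -
      have "(\<Union>J\<in>I. \<Union>(g J)) = (\<Union>J\<in>I. J)" using NC_onD(1)[OF gD] by auto
      also have "\<dots> = X" using I_subset I_cover by blast
      finally show ?thesis .
    qed
    moreover have "\<Union>(glue g) = S \<union> (\<Union>J\<in>I. \<Union>(g J))" by (auto simp: glue_def)
    ultimately show "\<Union>(glue g) = {..<n}" using S(1) by (auto simp: X_def)
    show "{} \<notin> glue g" using NC_onD(2)[OF gD] S(2) by (auto simp: glue_def)
    have SV: False if "J \<in> I" "V \<in> g J" "x \<in> V" "x \<in> S" for J V x
      using that g_subset I_subset by (fastforce simp: X_def)
    show "V = W" if V: "V \<in> glue g" and W: "W \<in> glue g" and x: "x \<in> V" "x \<in> W" for V W x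
    proof -
      consider "V = S" "W = S" | J where "V = S" "J \<in> I" "W \<in> g J" | J where "W = S" "J \<in> I" "V \<in> g J"
        | J J' where "J \<in> I" "V \<in> g J" "J' \<in> I" "W \<in> g J'"
        using glue_cases[OF V] glue_cases[OF W] by metis
      then show ?thesis
      proof cases
        case 4
        then have "J = J'" using disjoint[of J J' x] g_subset x by blast
        then show ?thesis using NC_onD(4)[OF gD] 4 x by blast
      qed (use SV x in blast)+
    qed
    show "noncrossing (glue g)"
      unfolding noncrossing_def
    proof (intro ballI allI impI)
      fix V W a b c d
      assume VW: "V \<in> glue g" "W \<in> glue g"
        and *: "a < b \<and> b < c \<and> c < d \<and> a \<in> V \<and> c \<in> V \<and> b \<in> W \<and> d \<in> W"
      consider "V = S" "W = S" | J where "V = S" "J \<in> I" "W \<in> g J" | J where "W = S" "J \<in> I" "V \<in> g J"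
        | J J' where "J \<in> I" "V \<in> g J" "J' \<in> I" "W \<in> g J'"
        using glue_cases[OF VW(1)] glue_cases[OF VW(2)] by metis
      then show "V = W"
      proof cases
        case 2
        then have "c \<in> J" using convex[of J b d c] g_subset * by auto
        then show ?thesis using I_subset[OF 2(2)] * 2(1) by (auto simp: X_def)
      next
        case 3
        then have "b \<in> J" using convex[of J a c b] g_subset * by auto
        then show ?thesis using I_subset[OF 3(2)] * 3(1) by (auto simp: X_def)
      next
        case 4
        then have "b \<in> J" using convex[of J a c b] g_subset * by auto
        then have "J = J'" using disjoint[of J J' b] 4 g_subset * by blast
        then show ?thesis using noncrossingD[OF NC_onD(3)[OF gD[OF 4(1)]] 4(2)] 4 * by blast
      qed auto
    qed
  qed
  then show ?thesis by (simp add: partitions_def glue_def)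
qed

lemma parts_glue: "parts (glue g) = g"
proof
  fix J
  show "parts (glue g) J = g J"
  proof (cases "J \<in> I")
    case True
    have "V \<in> g J" if V: "V \<in> glue g" "V \<subseteq> J" for V
    proof -
      have "V \<noteq> S" using I_subset[OF True] V(2) S(2) by (auto simp: X_def)
      then obtain J' where J': "J' \<in> I" "V \<in> g J'" using V(1) by (auto simp: glue_def)
      then obtain x where "x \<in> V" using NC_onD(2)[OF gD] by fastforce
      then have "J = J'" using disjoint[OF True J'(1), of x] V(2) g_subset[OF J'] by blast
      then show ?thesis using J' by simp
    qed
    then have "{V \<in> glue g. V \<subseteq> J} = g J"
      using g_subset[OF True] True by (auto simp: glue_def)
    then show ?thesis using True by (simp add: parts_def)
  next
    case False
    then show ?thesis using g by (simp add: parts_def PiE_def extensional_def)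
  qed
qed

text \<open>A block enclosing \<open>V\<close> is either \<open>S\<close> or, by convexity, a block
  of the same component. An element of \<open>S\<close> above one point of \<open>J\<close> is above
  all of \<open>J\<close>, again by convexity, and \<open>0\<close> always bounds \<open>J\<close>
  from below.\<close>

lemma inner_glue:
  assumes "J \<in> I" "V \<in> g J"
  shows "inner_block (glue g) V \<longleftrightarrow> inner_block (g J) V \<or> below J"
proof
  obtain v where v: "v \<in> V" using NC_onD(2)[OF gD[OF assms(1)]] assms(2) by fastforce
  have vJ: "v \<in> J" using v g_subset[OF assms] by blast
  assume "inner_block (glue g) V"
  then obtain W a b where W: "W \<in> glue g" "a \<in> W" "b \<in> W" "\<forall>c\<in>V. a < c \<and> c < b"
    by (auto simp: inner_block_def)
  show "inner_block (g J) V \<or> below J"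
  proof (cases "W = S")
    case True
    have "j < b" if "j \<in> J" for j
    proof (rule ccontr)
      assume "\<not> j < b"
      then have "b \<in> J" using convex[OF assms(1) vJ that, of b] W(4) v by auto
      then show False using I_subset[OF assms(1)] True W(3) by (auto simp: X_def)
    qed
    then show ?thesis using True W(3) by (auto simp: below_def)
  next
    case False
    then obtain J' where J': "J' \<in> I" "W \<in> g J'" using W(1) by (auto simp: glue_def)
    then have "v \<in> J'" using convex[OF J'(1), of a b v] g_subset W v by (auto simp: less_imp_le)
    then have "J' = J" using disjoint[OF J'(1) assms(1) _ vJ] by blast
    then show ?thesis using J' W unfolding inner_block_def by blast
  qed
next
  assume "inner_block (g J) V \<or> below J"
  then show "inner_block (glue g) V"
  proof
    assume "inner_block (g J) V"
    then show ?thesis using assms(1) unfolding inner_block_def glue_def by blast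
  next
    assume "below J"
    then obtain s where s: "s \<in> S" "\<forall>j\<in>J. j < s" by (auto simp: below_def)
    have "0 < c \<and> c < s" if "c \<in> V" for c
    proof -
      have "c \<in> J" using that g_subset[OF assms] by blast
      moreover have "c \<noteq> 0"
        using I_subset[OF assms(1)] \<open>c \<in> J\<close> S(2) by (metis DiffD2 X_def subsetD)
      ultimately show ?thesis using s by simp
    qed
    then show ?thesis using s(1) S(2) unfolding inner_block_def glue_def by blast
  qed
qed

end

lemma glue_parts:
  assumes "\<pi> \<in> partitions"
  shows "glue (parts \<pi>) = \<pi>"
proof -
  have \<pi>: "\<pi> \<in> NC_on {..<n}" "S \<in> \<pi>" using assms by (auto simp: partitions_def)
  have "\<exists>J\<in>I. V \<subseteq> J" if V: "V \<in> \<pi>" "V \<noteq> S" for V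
  proof -
    obtain x where x: "x \<in> V" using NC_onD(2)[OF \<pi>(1)] V(1) by fastforce
    then have "x \<in> X" using NC_onD(1)[OF \<pi>(1)] NC_onD(4)[OF \<pi>(1) V(1) \<pi>(2) x] V by (auto simp: X_def)
    then obtain J where "J \<in> I" "x \<in> J" using I_cover by blast
    then show ?thesis using block_subset[OF assms V] x by blast
  qed
  then show ?thesis using \<pi>(2) by (auto simp: glue_def parts_def)
qed

lemma not_inner: "\<not> inner_block \<pi> S"
  using S(2) by (auto simp: inner_block_def)

lemma finite_I: "finite I"
  by (simp add: I_def X_def)

lemma finite_J: "J \<in> I \<Longrightarrow> finite J"
  using I_subset by (rule finite_subset) (simp_all add: X_def)

text \<open>Along the bijection between partitions and families the weight factors over the
  components, with flags given by \<open>inner_glue\<close>; distributivity then turns the sum over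
  families into a product of sums.\<close>

lemma sum_partitions:
  "(\<Sum>\<pi>\<in>partitions. \<Prod>V\<in>\<pi>. w (inner_block \<pi> V) V) =
    w False S * (\<Prod>J\<in>I. nc_sum (\<lambda>b. w (b \<or> below J)) J)"
proof -
  have "(\<Sum>\<pi>\<in>partitions. \<Prod>V\<in>\<pi>. w (inner_block \<pi> V) V) =
    (\<Sum>g\<in>PiE I NC_on. w False S * (\<Prod>J\<in>I. \<Prod>V\<in>g J. w (inner_block (g J) V \<or> below J) V))"
  proof (rule sum.reindex_bij_witness[where i = glue and j = parts])
    fix \<pi> assume \<pi>: "\<pi> \<in> partitions"
    show "parts \<pi> \<in> PiE I NC_on" using parts_mem[OF \<pi>] .
    note g = this
    show "glue (parts \<pi>) = \<pi>" using glue_parts[OF \<pi>] .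
    have "(\<Prod>V\<in>glue (parts \<pi>). w (inner_block (glue (parts \<pi>)) V) V) =
        w (inner_block (glue (parts \<pi>)) S) S *
        (\<Prod>V\<in>(\<Union>J\<in>I. parts \<pi> J). w (inner_block (glue (parts \<pi>)) V) V)"
    proof -
      have "finite (\<Union>J\<in>I. parts \<pi> J)"
        using finite_I NC_on_finite[OF finite_J gD[OF g]] by blast
      moreover have "S \<notin> (\<Union>J\<in>I. parts \<pi> J)" using S_notin[OF g] by blast
      ultimately show ?thesis by (subst (1) glue_def) simp
    qed
    also have "(\<Prod>V\<in>(\<Union>J\<in>I. parts \<pi> J). w (inner_block (glue (parts \<pi>)) V) V) =
        (\<Prod>J\<in>I. \<Prod>V\<in>parts \<pi> J. w (inner_block (glue (parts \<pi>)) V) V)"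
    proof (rule prod.UNION_disjoint[OF finite_I])
      show "\<forall>J\<in>I. finite (parts \<pi> J)" using NC_on_finite[OF finite_J gD[OF g]] by blast
      show "\<forall>J\<in>I. \<forall>J'\<in>I. J \<noteq> J' \<longrightarrow> parts \<pi> J \<inter> parts \<pi> J' = {}"
      proof (intro ballI impI equals0I)
        fix J J' V assume J: "J \<in> I" "J' \<in> I" "J \<noteq> J'" and V: "V \<in> parts \<pi> J \<inter> parts \<pi> J'"
        obtain x where "x \<in> V" using NC_onD(2)[OF gD[OF g J(1)]] V by fastforce
        then show False using disjoint[OF J(1,2), of x] J(3) g_subset[OF g] V J(1,2) by blast
      qed
    qed
    also have "\<dots> = (\<Prod>J\<in>I. \<Prod>V\<in>parts \<pi> J. w (inner_block (parts \<pi> J) V \<or> below J) V)"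
      by (intro prod.cong refl) (simp add: inner_glue[OF g])
    finally show "w False S * (\<Prod>J\<in>I. \<Prod>V\<in>parts \<pi> J. w (inner_block (parts \<pi> J) V \<or> below J) V) =
        (\<Prod>V\<in>\<pi>. w (inner_block \<pi> V) V)"
      by (simp add: not_inner glue_parts[OF \<pi>])
  qed (simp_all add: parts_glue glue_mem)
  also have "\<dots> = w False S * (\<Prod>J\<in>I. nc_sum (\<lambda>b. w (b \<or> below J)) J)"
    unfolding nc_sum_def
    by (subst prod_sum_PiE) (auto simp: finite_I finite_J finite_NC_on sum_distrib_left)
  finally show ?thesis .
qed

end

lemma nc_sum_outer_block:
  assumes "0 < n"
  shows "nc_sum w {..<n} = (\<Sum>S\<in>{S. S \<subseteq> {..<n} \<and> 0 \<in> S}. w False S *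
    (\<Prod>J\<leftarrow>components ({..<n} - S). nc_sum (\<lambda>b. w (b \<or> (\<exists>s\<in>S. \<forall>j\<in>J. j < s))) J))"
proof -
  let ?T = "{S. S \<subseteq> {..<n} \<and> 0 \<in> S}"
  have fin: "finite ?T" by (rule finite_subset[of _ "Pow {..<n}"]) auto
  have un: "NC_on {..<n} = (\<Union>S\<in>?T. {\<pi> \<in> NC_on {..<n}. S \<in> \<pi>})"
  proof (intro equalityI subsetI)
    fix \<pi> assume \<pi>: "\<pi> \<in> NC_on {..<n}"
    then obtain V where "V \<in> \<pi>" "0 \<in> V" using NC_onD(1)[OF \<pi>] assms by blast
    then show "\<pi> \<in> (\<Union>S\<in>?T. {\<pi> \<in> NC_on {..<n}. S \<in> \<pi>})"
      using \<pi> NC_onD(1)[OF \<pi>] by auto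
  qed auto
  have "nc_sum w {..<n} =
    (\<Sum>S\<in>?T. \<Sum>\<pi>\<in>{\<pi> \<in> NC_on {..<n}. S \<in> \<pi>}. \<Prod>V\<in>\<pi>. w (inner_block \<pi> V) V)"
    unfolding nc_sum_def
  proof (subst un, rule sum.UNION_disjoint[OF fin])
    show "\<forall>S\<in>?T. finite {\<pi> \<in> NC_on {..<n}. S \<in> \<pi>}" by (simp add: finite_NC_on)
    show "\<forall>S\<in>?T. \<forall>S'\<in>?T. S \<noteq> S' \<longrightarrow>
        {\<pi> \<in> NC_on {..<n}. S \<in> \<pi>} \<inter> {\<pi> \<in> NC_on {..<n}. S' \<in> \<pi>} = {}"
      using NC_onD(4) by blast
  qed
  also have "\<dots> = (\<Sum>S\<in>?T. w False S *
    (\<Prod>J\<leftarrow>components ({..<n} - S). nc_sum (\<lambda>b. w (b \<or> (\<exists>s\<in>S. \<forall>j\<in>J. j < s))) J))"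
  proof (rule sum.cong[OF refl])
    fix S assume "S \<in> ?T"
    then interpret outer_block n S by unfold_locales auto
    have "I = set (components ({..<n} - S))" by (simp add: I_def X_def set_components)
    then show "(\<Sum>\<pi>\<in>{\<pi> \<in> NC_on {..<n}. S \<in> \<pi>}. \<Prod>V\<in>\<pi>. w (inner_block \<pi> V) V) = w False S *
        (\<Prod>J\<leftarrow>components ({..<n} - S). nc_sum (\<lambda>b. w (b \<or> (\<exists>s\<in>S. \<forall>j\<in>J. j < s))) J)"
      using sum_partitions[of w]
      by (simp add: partitions_def below_def prod.distinct_set_conv_list distinct_components)
  qed
  finally show ?thesis .
qed

lemma nths_shift:
  assumes "V \<subseteq> {..<l}"
  shows "nths (nths xs {m..<m + l}) V = nths xs ((+) m ` V)"
proof -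
  have "(+) m ` {..<l} = {m..<m + l}"
    using image_add_atLeastLessThan[of m 0 l] by (simp only: lessThan_atLeast0 add_0_left add.commute[of l])
  then have "nths xs {m..<m + l} = take l (drop m xs)"
    using nths_drop[of m xs "{..<l}"] by simp
  moreover have "nths (take l ys) V = nths ys V" for ys :: "'a list"
  proof (cases "l \<le> length ys")
    case True
    then have e: "{j. j + length (take l ys) \<in> V} = {}" using assms by auto
    have "nths ys V = nths (take l ys @ drop l ys) V" by simp
    also have "\<dots> = nths (take l ys) V" by (simp only: nths_append e nths_empty append_Nil2)
    finally show ?thesis by simp
  qed simp
  ultimately show ?thesis by (simp add: nths_drop)
qed

lemma NC_eq: "NC n = NC_on {..<n}"
  by (simp add: NC_def NC_on_def)

lemma nc_sum_cong:
  assumes "\<And>b V. V \<subseteq> X \<Longrightarrow> w b V = w' b V"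
  shows "nc_sum w X = nc_sum w' X"
  unfolding nc_sum_def
  by (intro sum.cong prod.cong refl assms) (use NC_onD(1) in blast)

section \<open>Moments as weighted sums over non-crossing partitions\<close>

definition cfree_weight ::
    "('a::monoid_mult \<Rightarrow> 'k::field) \<Rightarrow> ('a \<Rightarrow> 'k) \<Rightarrow> bool \<Rightarrow> 'a list \<Rightarrow> 'k" where
  "cfree_weight \<phi> \<psi> b as = (if b then free_cumulant \<psi> as else cfree_cumulant \<phi> \<psi> as)"

text \<open>If \<open>c\<close> holds, every block carries a free cumulant and the sum is a moment
  of \<open>\<psi>\<close>; otherwise it is the c-free moment-cumulant relation for
  \<open>\<phi>\<close>.\<close>

lemma nc_sum_moment:
  assumes "xs \<noteq> []"
  shows "nc_sum (\<lambda>b V. cfree_weight \<phi> \<psi> (b \<or> c) (nths xs V)) {..<length xs} =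
    (if c then \<psi> (prod_list xs) else \<phi> (prod_list xs))"
proof (cases c)
  case True
  then show ?thesis
    using free_moment_cumulant[OF assms, of \<psi>] by (simp add: nc_sum_def NC_eq cfree_weight_def)
next
  case False
  have "(\<Prod>V\<in>\<pi>. cfree_weight \<phi> \<psi> (inner_block \<pi> V) (nths xs V)) =
     (\<Prod>V \<in> {V\<in>\<pi>. inner_block \<pi> V}. free_cumulant \<psi> (nths xs V)) *
     (\<Prod>V \<in> {V\<in>\<pi>. \<not> inner_block \<pi> V}. cfree_cumulant \<phi> \<psi> (nths xs V))"
    if "\<pi> \<in> NC_on {..<length xs}" for \<pi>
    using NC_on_finite[OF _ that] unfolding cfree_weight_def
    by (subst prod.If_cases) (simp_all add: Int_def)
  then show ?thesis
    using cfree_moment_cumulant[OF assms, of \<phi> \<psi>] False by (simp add: nc_sum_def NC_eq)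
qed

text \<open>A convex set of positions is an interval; translating it to an initial segment reduces
  the claim to the moments of the subword.\<close>

lemma nc_sum_interval:
  assumes "J \<subseteq> {..<length xs}" "J \<noteq> {}" "\<And>a b x. a \<in> J \<Longrightarrow> b \<in> J \<Longrightarrow> a \<le> x \<Longrightarrow> x \<le> b \<Longrightarrow> x \<in> J"
  shows "nc_sum (\<lambda>b V. cfree_weight \<phi> \<psi> (b \<or> c) (nths xs V)) J =
    (if c then \<psi> (prod_list (nths xs J)) else \<phi> (prod_list (nths xs J)))"
proof -
  have fin: "finite J" using assms(1) finite_subset by blast
  define m l where "m = Min J" and "l = Suc (Max J) - Min J"
  have mm: "Min J \<in> J" "Max J \<in> J" "Min J \<le> Max J" using fin assms(2) by auto
  have J: "J = {m..<m + l}"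
  proof -
    have "m + l = Suc (Max J)" using mm(3) by (simp add: m_def l_def)
    moreover have "{m..<Suc (Max J)} = J"
      using assms(3)[OF mm(1,2)] fin by (auto simp: m_def less_Suc_eq_le)
    ultimately show ?thesis by simp
  qed
  have img: "(+) m ` {..<l} = {m..<m + l}"
    using image_add_atLeastLessThan[of m 0 l] by (simp only: lessThan_atLeast0 add_0_left add.commute[of l])
  let ?ys = "nths xs J"
  have "{i. i < length xs \<and> i \<in> J} = J" using assms(1) by auto
  moreover have "card J = l" by (subst J) simp
  ultimately have len: "length ?ys = l" by (simp add: length_nths)
  have "0 < l" using mm(3) by (simp add: l_def)
  then have ne: "?ys \<noteq> []" using len by auto
  have "nc_sum (\<lambda>b V. cfree_weight \<phi> \<psi> (b \<or> c) (nths xs V)) J =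
      nc_sum (\<lambda>b V. cfree_weight \<phi> \<psi> (b \<or> c) (nths xs ((+) m ` V))) {..<l}"
    by (simp only: J img[symmetric] nc_sum_shift)
  also have "\<dots> = nc_sum (\<lambda>b V. cfree_weight \<phi> \<psi> (b \<or> c) (nths ?ys V)) {..<l}"
    by (rule nc_sum_cong) (simp add: J nths_shift)
  also have "\<dots> = (if c then \<psi> (prod_list ?ys) else \<phi> (prod_list ?ys))"
    using nc_sum_moment[OF ne] by (simp only: len)
  finally show ?thesis .
qed

lemma cfree_moment_dsum:
  fixes \<phi> \<psi> :: "'a::monoid_mult \<Rightarrow> 'k::field"
  assumes "\<Psi> [] = 1" "\<And>w w'. \<Psi> (w @ w') = \<Psi> w * \<Psi> w'"
    and \<Psi>: "\<And>as. as \<noteq> [] \<Longrightarrow> \<Psi> (bar as) = \<psi> (prod_list as)"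
    and h: "h [] = 1" "\<And>as. as \<noteq> [] \<Longrightarrow> h as = \<phi> (prod_list as)"
    and "xs \<noteq> []"
  shows "h xs = dsum id xs (\<lambda>u v r. cfree_cumulant \<phi> \<psi> u * (\<Psi> v * h r))"
proof -
  let ?n = "length xs"
  let ?w = "\<lambda>b V. cfree_weight \<phi> \<psi> b (nths xs V)"
  have "h xs = nc_sum ?w {..<?n}"
    using nc_sum_moment[OF \<open>xs \<noteq> []\<close>, of \<phi> \<psi> False] h(2)[OF \<open>xs \<noteq> []\<close>] by simp
  also have "\<dots> = (\<Sum>S\<in>{S. S \<subseteq> {..<?n} \<and> 0 \<in> S}. ?w False S *
      (\<Prod>J\<leftarrow>components ({..<?n} - S). nc_sum (\<lambda>b. ?w (b \<or> (\<exists>s\<in>S. \<forall>j\<in>J. j < s))) J))"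
    using \<open>xs \<noteq> []\<close> by (intro nc_sum_outer_block) simp
  also have "\<dots> = dsum id xs (\<lambda>u v r. cfree_cumulant \<phi> \<psi> u * (\<Psi> v * h r))"
    unfolding dsum_def id_apply
  proof (rule sum.cong[OF refl])
    fix S assume "S \<in> {S. S \<subseteq> {..<?n} \<and> 0 \<in> S}"
    then have S: "S \<subseteq> {..<?n}" "0 \<in> S" by auto
    let ?f = "\<lambda>J. nc_sum (\<lambda>b. ?w (b \<or> (\<exists>s\<in>S. \<forall>j\<in>J. j < s))) J"
    let ?gaps = "components ({..<cut S} - S)"
    note cut = cut_props[OF S(1)]
    have "cut S \<noteq> 0" using S(2) by (auto simp: cut_def)
    \<comment> \<open>This last selected position decides the flags: every gap lies in front of it
      and the tail behind it.\<close>
    then have last: "cut S - 1 \<in> S" using cut(3) by simp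
    have J: "?f J = (if \<exists>s\<in>S. \<forall>j\<in>J. j < s then \<psi> (prod_list (nths xs J)) else \<phi> (prod_list (nths xs J)))"
      if "J \<in> set (components ({..<?n} - S))" for J
    proof (rule nc_sum_interval[where c = "\<exists>s\<in>S. \<forall>j\<in>J. j < s" and xs = xs and J = J])
      have J: "J \<in> conn_component ({..<?n} - S) ` ({..<?n} - S)"
        using that set_components[of "{..<?n} - S"] by (simp only: finite_Diff finite_lessThan)
      then obtain i where i: "i \<in> {..<?n} - S" "J = conn_component ({..<?n} - S) i" by (rule imageE)
      show "J \<subseteq> {..<?n}" unfolding i(2) using conn_component_subset by (rule subset_trans) simp
      show "J \<noteq> {}" unfolding i(2) using conn_component_self[OF i(1)] by auto
      show "x \<in> J" if "a \<in> J" "b \<in> J" "a \<le> x" "x \<le> b" for a b x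
        using J that by (rule conn_component_convex)
    qed
    \<comment> \<open>A gap is enclosed by \<open>0\<close> and \<open>cut S - 1\<close>, so all its
      blocks count as inner and sum to a moment of \<open>\<psi>\<close>.\<close>
    have gap: "?f J = \<Psi> (bar (nths xs J))" if "J \<in> set ?gaps" for J
    proof -
      have J1: "J \<in> set (components ({..<?n} - S))" using that by (simp add: components_cut[OF S(1)])
      have J2: "J \<subseteq> {..<cut S} - S" "J \<noteq> {}"
        using that conn_component_subset[of "{..<cut S} - S"] conn_component_self[of _ "{..<cut S} - S"]
        by (auto simp: set_components)
      have "j < cut S - 1" if "j \<in> J" for j
      proof -
        have "j < cut S" "j \<noteq> cut S - 1" using J2(1) that last by auto
        then show ?thesis by simp
      qed
      then have ex: "\<exists>s\<in>S. \<forall>j\<in>J. j < s" using last by blast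
      obtain j where "j \<in> J" "j < ?n" using J2 cut(2) by fastforce
      then have "xs ! j \<in> set (nths xs J)" by (auto simp: set_nths)
      then have "nths xs J \<noteq> []" by (metis empty_iff list.set(1))
      then show ?thesis unfolding J[OF J1] if_P[OF ex] by (rule \<Psi>[symmetric])
    qed
    \<comment> \<open>No element of \<open>S\<close> follows the tail, so its blocks keep their own
      flags and sum to a moment of \<open>\<phi>\<close>. An absent tail is covered by
      \<open>h [] = 1\<close>.\<close>
    have tail: "?f {cut S..<?n} = h (drop (cut S) xs)" if "cut S < ?n"
    proof -
      have J1: "{cut S..<?n} \<in> set (components ({..<?n} - S))"
        using that by (simp add: components_cut[OF S(1)])
      have "\<not> (\<exists>s\<in>S. \<forall>j\<in>{cut S..<?n}. j < s)"
      proof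
        assume "\<exists>s\<in>S. \<forall>j\<in>{cut S..<?n}. j < s"
        then obtain s where s: "s \<in> S" "\<forall>j\<in>{cut S..<?n}. j < s" by blast
        have "cut S < s" using s(2) that by simp
        moreover have "s < cut S" using s(1) cut(1) by blast
        ultimately show False by simp
      qed
      moreover have "drop (cut S) xs \<noteq> []" using that by simp
      ultimately show ?thesis
        unfolding J[OF J1] nths_atLeastLessThan using h(2)[of "drop (cut S) xs"] by (simp only: if_False not_False_eq_True)
    qed
    have \<Psi>_concat: "\<Psi> (concat (map F js)) = (\<Prod>J\<leftarrow>js. \<Psi> (F J))" for F and js :: "nat set list"
      by (induction js) (simp_all add: assms(1,2))
    have "(\<Prod>J\<leftarrow>?gaps. ?f J) = (\<Prod>J\<leftarrow>?gaps. \<Psi> (bar (nths xs J)))"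
      by (intro arg_cong[of _ _ prod_list] map_cong refl gap)
    also have "\<dots> = \<Psi> (gaps xs S)" by (simp only: gaps_def \<Psi>_concat)
    finally have "(\<Prod>J\<leftarrow>components ({..<?n} - S). ?f J) = \<Psi> (gaps xs S) * h (drop (cut S) xs)"
      using tail cut(2) by (simp add: components_cut[OF S(1)] h(1))
    then show "?w False S * (\<Prod>J\<leftarrow>components ({..<?n} - S). ?f J) =
        cfree_cumulant \<phi> \<psi> (nths xs S) * (\<Psi> (gaps xs S) * h (drop (cut S) xs))"
      by (simp add: cfree_weight_def)
  qed
  finally show ?thesis .
qed

section \<open>Conditionally free cumulants\<close>

theorem corollary18:
  fixes scale :: "'k::field \<Rightarrow> 'a::ring_1 \<Rightarrow> 'a"
    and \<phi> \<psi> :: "'a \<Rightarrow> 'k"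
    and \<Phi> \<Psi> \<beta> R :: "'a barword \<Rightarrow> 'k"
  assumes "unital_algebra scale"
    and "unital_linear scale \<phi>" and "unital_linear scale \<psi>"
    and "\<Phi> \<in> characters scale" and "\<And>as. as \<noteq> [] \<Longrightarrow> \<Phi> (bar as) = \<phi> (prod_list as)"
    and "\<Psi> \<in> characters scale" and "\<And>as. as \<noteq> [] \<Longrightarrow> \<Psi> (bar as) = \<psi> (prod_list as)"
    and "\<beta> \<in> inf_characters scale" and "\<Phi> = exp_right \<beta>"
    and "R \<in> inf_characters scale"
  shows "(\<beta> = inv\<^bsub>character_group scale\<^esub> \<Psi> \<succ> R \<prec> \<Psi> \<longleftrightarrow>
            R = \<Psi> \<succ> \<beta> \<prec> inv\<^bsub>character_group scale\<^esub> \<Psi>) \<and>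
         (\<beta> = inv\<^bsub>character_group scale\<^esub> \<Psi> \<succ> R \<prec> \<Psi> \<longrightarrow>
            (\<forall>as. as \<noteq> [] \<longrightarrow> R (bar as) = cfree_cumulant \<phi> \<psi> as))"
proof -
  let ?\<Psi>' = "inv\<^bsub>character_group scale\<^esub> \<Psi>"
  have vs: "vector_space scale"
    using assms(1) by (simp add: unital_algebra_def)
  have \<Psi>: "\<Psi> [] = 1" "\<And>w w'. \<Psi> (w @ w') = \<Psi> w * \<Psi> w'"
    using assms(6) by (auto simp: characters_def)
  have Nil: "\<beta> [] = 0" "R [] = 0"
    using assms(8,10) by (auto simp: inf_characters_def)
  note inv = character_inverse[OF vs assms(6)]
  \<comment> \<open>Facts 1, 2 and 3 form a cycle through the equation without inverse, which gives
    the equivalence of the two relations.\<close>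
  have 1: "\<Psi> \<succ> \<beta> = R \<prec> \<Psi>" if "\<beta> = ?\<Psi>' \<succ> R \<prec> \<Psi>"
  proof -
    have "\<Psi> \<succ> \<beta> = \<Psi> \<succ> (?\<Psi>' \<succ> R) \<prec> \<Psi>"
      by (subst that) (simp only: half_right_half_left half_right_Nil Nil)
    also have "\<dots> = R \<prec> \<Psi>"
      by (simp only: half_right_half_right Nil inv half_right_counit)
    finally show ?thesis .
  qed
  have 2: "R = \<Psi> \<succ> \<beta> \<prec> ?\<Psi>'" if "\<Psi> \<succ> \<beta> = R \<prec> \<Psi>"
    by (simp only: that half_left_half_left Nil inv half_left_counit)
  have 3: "\<beta> = ?\<Psi>' \<succ> R \<prec> \<Psi>" if "R = \<Psi> \<succ> \<beta> \<prec> ?\<Psi>'"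
  proof -
    have "R \<prec> \<Psi> = \<Psi> \<succ> \<beta>"
      by (subst that) (simp only: half_left_half_left half_right_Nil Nil inv half_left_counit)
    then show ?thesis
      by (simp only: half_right_half_left half_right_half_right Nil inv half_right_counit)
  qed
  \<comment> \<open>\<open>R\<close> and the c-free cumulants both solve the same triangular system
    for \<open>\<Phi>\<close>.\<close>
  have 4: "R (bar as) = cfree_cumulant \<phi> \<psi> as"
    if eq: "\<Psi> \<succ> \<beta> = R \<prec> \<Psi>" and as: "as \<noteq> []" for as
  proof (rule dsum_left_unique[where C = "\<lambda>u. R (bar u)" and h = "\<lambda>r. \<Phi> (bar r)" and \<Psi> = \<Psi>])
    show \<Phi>1: "\<Phi> (bar []) = 1" using assms(4) by (simp add: characters_def)
    fix xs :: "'a list" assume xs: "xs \<noteq> []"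
    have "dsum id xs (\<lambda>u v r. R (bar u) * (\<Psi> v * \<Phi> (bar r))) = \<Phi> (bar xs)"
      unfolding assms(9) by (rule exp_right_eq_dsum[OF assms(8) Nil(2) \<Psi> eq xs, symmetric])
    also have "\<dots> = dsum id xs (\<lambda>u v r. cfree_cumulant \<phi> \<psi> u * (\<Psi> v * \<Phi> (bar r)))"
      by (rule cfree_moment_dsum[where h = "\<lambda>r. \<Phi> (bar r)", OF \<Psi> assms(7) \<Phi>1 assms(5) xs])
    finally show "dsum id xs (\<lambda>u v r. R (bar u) * (\<Psi> v * \<Phi> (bar r))) =
        dsum id xs (\<lambda>u v r. cfree_cumulant \<phi> \<psi> u * (\<Psi> v * \<Phi> (bar r)))" .
  qed (simp_all add: \<Psi> as)
  show ?thesis using 1 2 3 4 by blast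
qed

end
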